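(* Let $k\ge3$ and let $(A_n)_{n=1}^\infty$ be a homogeneous admissible set system in $[0,1]^k$ with parameter $\tau$ (see context). Let $\boldsymbol\gamma_{n,n'}\in\mathbb{R}^k$ for $n,n'\in\mathbb{N}$ be arbitrary. Then \[ \sum_{n,n'\le N}\lambda(A_n\cap(A_{n'}+\boldsymbol\gamma_{n,n'}))\le\Bigl(\sum_{n\le N}\lambda(A_n)\Bigr)^2+O\Bigl(\sum_{n\le N}\lambda(A_n)\Bigr). \]
   Context: $\lambda$ is Lebesgue measure, with sets regarded modulo $\mathbb{Z}^k$ (i.e. on the torus $[0,1)^k$); $\|\cdot\|$ is the distance to the nearest integer. Admissible set system: fix $\tau\in(0,1/k)$ and $\mathbf{y}\in\mathbb{R}^k$ ($\mathbf{y}=\mathbf{0}$ for a homogeneous system). For $m\in\mathbb{N}$ let $D_m=[2^{m-1},2^m)$. For each $m$ choose a finite index set $I_m$ and, for $i\in I_m$, $1\le j\le k$, numbers $d_{i,j}=d_{i,j,m}>0$ with $d_{i,j}\le1/(2n)$ and $n^{-(1+1/k+\tau)}\ll d_{i,j}\ll n^{-(1+1/k-\tau)}$ for all $n\in D_m$, such that $\prod_jd_{i,j}$ does not depend on $i$. To each $(i,j)$ associate $\mathcal{U}_{i,j}$ equal to $[0,nd_{i,j})$ or $[nd_{i,j}/2,nd_{i,j})$. For $n\in D_m$ let $A_n=\bigcup_{i\in I_m}\{\mathbf{x}\in[0,1]^k:\|nx_j-y_j\|\in\mathcal{U}_{i,j}\ \forall j\}$, required to be a disjoint union and to satisfy Property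 $\mathcal{P}_n(\mathbf{y})$: modulo $\mathbb{Z}^k$, $A_n=\mathcal{Z}+n^{-1}(\mathbf{y}+\mathbb{Z}^k)$ for some strongly star-shaped $\mathcal{Z}\subseteq[-1/2,1/2]^k$ (meaning $\mathbf{x}\in\mathcal{Z}$ and $|z_j|\le|x_j|$ for all $j$ imply $\mathbf{z}\in\mathcal{Z}$). The implied constant is independent of $N$ and of the shifts $\boldsymbol\gamma_{n,n'}$. *)

theory Defs
  imports "HOL-Analysis.Analysis"
begin

definition nint_dist :: "real \<Rightarrow> real"
  where "nint_dist x = \<bar>x - of_int (round x)\<bar>"

definition int_lattice :: "(real ^ 'k) set"
  where "int_lattice = {a. \<forall>j. a $ j \<in> \<int>}"

text \<open>
  A subset of the torus is represented by its representatives in \<open>[0,1)\<^sup>k\<close>.  Sets must be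
  reduced \<^emph>\<open>before\<close> they are intersected.
\<close>
definition torus :: "(real ^ 'k) set \<Rightarrow> (real ^ 'k) set"
  where "torus S = {x. (\<forall>j. 0 \<le> x $ j \<and> x $ j < 1) \<and> (\<exists>a\<in>int_lattice. x + a \<in> S)}"

definition strongly_star_shaped :: "(real ^ 'k) set \<Rightarrow> bool"
  where "strongly_star_shaped Z \<longleftrightarrow>
    (\<forall>x\<in>Z. \<forall>z. (\<forall>j. \<bar>z $ j\<bar> \<le> \<bar>x $ j\<bar>) \<longrightarrow> z \<in> Z)"

definition property_P :: "nat \<Rightarrow> real ^ 'k \<Rightarrow> (real ^ 'k) set \<Rightarrow> bool"
  where "property_P n y S \<longleftrightarrow>
    (\<exists>Z. strongly_star_shaped Z \<and> (\<forall>z\<in>Z. \<forall>j. - (1/2) \<le> z $ j \<and> z $ j \<le> 1/2) \<and>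
      torus S = torus {z + (1 / real n) *\<^sub>R (y + a) | z a. z \<in> Z \<and> a \<in> int_lattice})"

definition dyadic :: "nat \<Rightarrow> nat set"
  where "dyadic m = {2 ^ (m - 1) ..< 2 ^ m}"

text \<open>
  The data \<open>I\<close>, \<open>d\<close>, \<open>U\<close> are indexed by the dyadic level \<open>m \<ge> 1\<close>.  Which of the two shapes
  \<open>U m i j\<close> takes may depend on \<open>m\<close>, \<open>i\<close>, \<open>j\<close>, but not on \<open>n \<in> dyadic m\<close>; the interval
  itself is \<open>U m i j n\<close>.  The constants in \<open>d_bounds\<close> are uniform in \<open>m\<close>, \<open>i\<close>, \<open>j\<close>, \<open>n\<close>.
\<close>
locale admissible_set_system =
  fixes \<tau> :: real
    and y :: "real ^ 'k"
    and I :: "nat \<Rightarrow> 'i set"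
    and d :: "nat \<Rightarrow> 'i \<Rightarrow> 'k \<Rightarrow> real"
    and U :: "nat \<Rightarrow> 'i \<Rightarrow> 'k \<Rightarrow> nat \<Rightarrow> real set"
    and A :: "nat \<Rightarrow> (real ^ 'k) set"
  assumes tau: "0 < \<tau>" "\<tau> < 1 / real CARD('k)"
    and finite_I: "\<And>m. 1 \<le> m \<Longrightarrow> finite (I m)"
    and d_pos: "\<And>m i j. 1 \<le> m \<Longrightarrow> i \<in> I m \<Longrightarrow> 0 < d m i j"
    and d_le: "\<And>m i j n. 1 \<le> m \<Longrightarrow> i \<in> I m \<Longrightarrow> n \<in> dyadic m \<Longrightarrow> d m i j \<le> 1 / (2 * real n)"
    and d_bounds: "\<exists>c>0. \<exists>C>0. \<forall>m\<ge>1. \<forall>i\<in>I m. \<forall>j. \<forall>n\<in>dyadic m.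
        c * real n powr (- (1 + 1 / real CARD('k) + \<tau>)) \<le> d m i j \<and>
        d m i j \<le> C * real n powr (- (1 + 1 / real CARD('k) - \<tau>))"
    and prod_d: "\<And>m i i'. 1 \<le> m \<Longrightarrow> i \<in> I m \<Longrightarrow> i' \<in> I m \<Longrightarrow>
        (\<Prod>j\<in>UNIV. d m i j) = (\<Prod>j\<in>UNIV. d m i' j)"
    and U: "\<And>m i j. 1 \<le> m \<Longrightarrow> i \<in> I m \<Longrightarrow>
        U m i j = (\<lambda>n. {0 ..< real n * d m i j}) \<or>
        U m i j = (\<lambda>n. {real n * d m i j / 2 ..< real n * d m i j})"
    and A: "\<And>m n. 1 \<le> m \<Longrightarrow> n \<in> dyadic m \<Longrightarrow>
        A n = (\<Union>i\<in>I m. {x. \<forall>j. 0 \<le> x $ j \<and> x $ j \<le> 1 \<and>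
                               nint_dist (real n * x $ j - y $ j) \<in> U m i j n})"
    and disjoint: "\<And>m n. 1 \<le> m \<Longrightarrow> n \<in> dyadic m \<Longrightarrow>
        disjoint_family_on (\<lambda>i. {x. \<forall>j. 0 \<le> x $ j \<and> x $ j \<le> 1 \<and>
                               nint_dist (real n * x $ j - y $ j) \<in> U m i j n}) (I m)"
    and property_P: "\<And>m n. 1 \<le> m \<Longrightarrow> n \<in> dyadic m \<Longrightarrow> property_P n y (A n)"

end

theory Submission
  imports Defs "HOL-Computational_Algebra.Primes"
begin

text \<open>
  Each \<open>A\<^sub>n\<close> is \<open>Z\<^sub>n + n\<^sup>-\<^sup>1\<int>\<^sup>k\<close> with \<open>Z\<^sub>n\<close> strongly star-shaped and contained in a cube of side
  \<open>\<lless> n\<^sup>-\<^sup>1\<^sup>-\<^sup>\<eta>\<close>, where \<open>\<eta> = 1/k - \<tau>\<close>.  Averaging over the translations that fix \<open>A\<^sub>n\<close> bounds the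
  overlap by \<open>\<lambda>(A\<^sub>n) n\<^sup>-\<^sup>k\<close> times the number of points of a translate of \<open>n\<^sup>-\<^sup>1\<int>\<^sup>k / \<int>\<^sup>k\<close> in \<open>A\<^sub>n\<^sub>'\<close>.
  Modulo \<open>n'\<^sup>-\<^sup>1\<int>\<^sup>k\<close> these points cover a translate of \<open>L\<^sup>-\<^sup>1\<int>\<^sup>k\<close>, \<open>L = lcm(n,n')\<close>, with multiplicity
  \<open>g\<^sup>k\<close>, \<open>g = gcd(n,n')\<close>.  A strongly star-shaped \<open>Z\<close> in a cube of side \<open>D\<close> contains at most
  \<open>L\<^sup>k\<lambda>(Z) + (X+1)\<^sup>k - X\<^sup>k\<close> points of any translate of \<open>L\<^sup>-\<^sup>1\<int>\<^sup>k\<close>, where \<open>X = O(LD)\<close>: the first term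
  has constant one, and the lowest-order term is one.  Hence the overlap is at most
  \<open>\<lambda>(A\<^sub>n)\<lambda>(A\<^sub>n\<^sub>') + \<lambda>(A\<^sub>n)((g/n)\<^sup>3 + K (g/n) n'\<^sup>-\<^sup>\<eta>)\<close>.  Summed over \<open>n' \<le> n\<close>, the first error is bounded
  because \<open>k \<ge> 3\<close>, and the second one by the divisor bound.  The range \<open>n' > n\<close> follows by symmetry,
  with the roles of \<open>n\<close> and \<open>n'\<close> exchanged.
\<close>

section \<open>Divisor sums\<close>

text \<open>\<open>gcd n n'\<close> is itself a common divisor, so \<open>F (gcd n n')\<close> is
  one term of the nonnegative sum over all common divisors \<open>d\<close>. After exchanging the
  sums, each \<open>d\<close> is weighted by the number of its multiples up to
  \<open>n\<close>.\<close>

lemma sum_gcd_le: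
  fixes F :: "nat \<Rightarrow> real"
  assumes n: "n > 0" and F: "\<And>d. F d \<ge> 0"
  shows "(\<Sum>n'=1..n. F (gcd n n')) \<le> (\<Sum>d | d dvd n. F d * real (n div d))"
proof -
  have fin: "finite {d. d dvd n}" using n by (simp add: finite_divisors_nat)
  have cardle: "card {n' \<in> {1..n}. d dvd n'} \<le> n div d" if "d dvd n" for d
  proof -
    have d: "d > 0" using that n by (auto intro: Nat.gr0I)
    have "{n' \<in> {1..n}. d dvd n'} \<subseteq> (\<lambda>i. d * i) ` {1..n div d}"
    proof
      fix x assume "x \<in> {n' \<in> {1..n}. d dvd n'}"
      then obtain i where "x = d * i" "1 \<le> x" "x \<le> n" by (auto elim: dvdE)
      moreover from this d have "i \<le> n div d" by (simp add: less_eq_div_iff_mult_less_eq mult.commute)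
      moreover have "1 \<le> i" using calculation(1,2) by (cases i) auto
      ultimately show "x \<in> (\<lambda>i. d * i) ` {1..n div d}" by auto
    qed
    then have "card {n' \<in> {1..n}. d dvd n'} \<le> card {1..n div d}"
      by (intro surj_card_le) auto
    then show ?thesis by simp
  qed
  have "(\<Sum>n'=1..n. F (gcd n n')) \<le> (\<Sum>n'=1..n. \<Sum>d | d dvd n. if d dvd n' then F d else 0)"
  proof (rule sum_mono)
    fix n'
    have "F (gcd n n') = (\<Sum>d\<in>{gcd n n'}. if d dvd n' then F d else 0)" by simp
    also have "\<dots> \<le> (\<Sum>d | d dvd n. if d dvd n' then F d else 0)"
      using fin F by (intro sum_mono2) auto
    finally show "F (gcd n n') \<le> \<dots>" .
  qed
  also have "\<dots> = (\<Sum>d | d dvd n. \<Sum>n'=1..n. if d dvd n' then F d else 0)"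
    by (rule sum.swap)
  also have "\<dots> = (\<Sum>d | d dvd n. F d * real (card {n' \<in> {1..n}. d dvd n'}))"
    by (intro sum.cong refl) (simp add: sum.If_cases Int_def mult.commute)
  also have "\<dots> \<le> (\<Sum>d | d dvd n. F d * real (n div d))"
    using F cardle by (intro sum_mono mult_left_mono) (auto simp only: of_nat_le_iff)
  finally show ?thesis .
qed

lemma sum_inverse_squares_le: "(\<Sum>e=1..n. 1 / real e ^ 2) \<le> 2"
proof -
  \<comment> \<open>The claim is strengthened by \<open>- 1 / real n\<close> so that the induction
    telescopes.\<close>
  have "(\<Sum>e=1..n. 1 / real e ^ 2) \<le> 2 - 1 / real n" if "n \<ge> 1" for n
    using that
  proof (induction n rule: dec_induct)
    case (step n)
    then have "1 / real (Suc n) ^ 2 \<le> 1 / real n - 1 / real (Suc n)"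
      by (simp add: divide_simps power2_eq_square)
    with step show ?case by simp
  qed simp
  from this[of n] show ?thesis by (cases "n = 0") (auto intro: order_trans)
qed

text \<open>With e = n/d, a divisor d contributes e^-3 and is counted at most e times, which leaves
  the convergent series of e^-2. The exponent 3 comes from the dimension being at least 3.\<close>

lemma sum_gcd_cube_le:
  assumes n: "n > 0"
  shows "(\<Sum>n'=1..n. (real (gcd n n') / real n) ^ 3) \<le> 2"
proof -
  have fin: "finite {d. d dvd n}" using n by (simp add: finite_divisors_nat)
  have "(\<Sum>n'=1..n. (real (gcd n n') / real n) ^ 3) \<le> (\<Sum>d | d dvd n. (real d / real n) ^ 3 * real (n div d))"
    using sum_gcd_le[OF n, of "\<lambda>d. (real d / real n) ^ 3"] by simp
  also have "\<dots> = (\<Sum>d | d dvd n. 1 / real (n div d) ^ 2)"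
    using n by (intro sum.cong refl) (auto elim!: dvdE simp: field_simps power2_eq_square power3_eq_cube)
  also have "\<dots> = (\<Sum>e\<in>(\<lambda>d. n div d) ` {d. d dvd n}. 1 / real e ^ 2)"
  proof (subst sum.reindex)
    show "inj_on (\<lambda>d. n div d) {d. d dvd n}"
      using n by (intro inj_onI) (metis (mono_tags) dvd_div_eq_0_iff dvd_mult_div_cancel mem_Collect_eq mult_right_cancel neq0_conv)
  qed auto
  also have "\<dots> \<le> (\<Sum>e=1..n. 1 / real e ^ 2)"
    using n by (intro sum_mono2) (auto elim!: dvdE)
  also have "\<dots> \<le> 2" by (rule sum_inverse_squares_le)
  finally show ?thesis .
qed

text \<open>A divisor is determined by its exponents at the primes dividing \<open>n\<close>, and
  each exponent is at most that of \<open>n\<close>.\<close>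

lemma card_divisors_le:
  assumes n: "(n::nat) > 0"
  shows "card {d. d dvd n} \<le> (\<Prod>p\<in>prime_factors n. multiplicity p n + 1)"
proof -
  let ?f = "\<lambda>d. restrict (\<lambda>p. multiplicity p d) (prime_factors n)"
  let ?P = "PiE (prime_factors n) (\<lambda>p. {0..multiplicity p n})"
  have "inj_on ?f {d. d dvd n}"
  proof (rule inj_onI)
    fix a b assume ab: "a \<in> {d. d dvd n}" "b \<in> {d. d dvd n}" "?f a = ?f b"
    then have nz: "a \<noteq> 0" "b \<noteq> 0" using n by auto
    have "multiplicity p a = multiplicity p b" if p: "prime p" for p
    proof (cases "p \<in> prime_factors n")
      case True
      then show ?thesis using ab(3) by (metis restrict_apply')
    next
      case False
      then have "\<not> p dvd n" using n p by (simp add: in_prime_factors_iff)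
      then have "\<not> p dvd a" "\<not> p dvd b" using ab by (auto dest: dvd_trans)
      then show ?thesis by (simp add: not_dvd_imp_multiplicity_0)
    qed
    then show "a = b" using nz by (auto intro: multiplicity_eq_nat)
  qed
  moreover have "?f ` {d. d dvd n} \<subseteq> ?P"
    using n by (auto intro!: dvd_imp_multiplicity_le)
  moreover have "finite ?P" by (intro finite_PiE) auto
  ultimately have "card {d. d dvd n} \<le> card ?P"
    by (rule card_inj_on_le)
  also have "\<dots> = (\<Prod>p\<in>prime_factors n. multiplicity p n + 1)"
    by (simp add: card_PiE)
  finally show ?thesis .
qed

text \<open>The quotient of the divisor function by n^\<delta> is bounded prime by prime. A prime p
  \<ge> \<open>P\<close> with exponent a has a + 1 \<le> p^(a \<delta>); a smaller prime costs a
  further factor \<open>M\<close>, and there are at most \<open>P\<close> of those.\<close>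

lemma divisor_bound:
  fixes \<delta> :: real
  assumes \<delta>: "\<delta> > 0"
  shows "\<exists>K>0. \<forall>n>0. real (card {d. d dvd n}) \<le> K * real n powr \<delta>"
proof -
  \<comment> \<open>\<open>M\<close> makes a \<le> M a \<delta> ln 2 hold, so that exp x \<ge> 1 + x
    settles every prime p \<ge> 2. \<open>P\<close> is the threshold beyond which p^\<delta> \<ge>
    2, so that a + 1 \<le> 2^a suffices.\<close>
  define M where "M = max 1 (1 / (\<delta> * ln 2)) "
  define P where "P = nat \<lceil>2 powr (1 / \<delta>)\<rceil>"
  have M1: "M \<ge> 1" by (simp add: M_def)
  have small: "real a + 1 \<le> M * real p powr (real a * \<delta>)" if "p \<ge> 2" for a p :: nat
  proof -
    have "1 + real a * (\<delta> * ln 2) \<le> exp (real a * (\<delta> * ln 2))" by (rule exp_ge_add_one_self)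
    also have "\<dots> = 2 powr (real a * \<delta>)" by (simp add: powr_def mult.assoc)
    also have "\<dots> \<le> real p powr (real a * \<delta>)" using that \<delta> by (intro powr_mono2) auto
    finally have e: "1 + real a * (\<delta> * ln 2) \<le> real p powr (real a * \<delta>)" .
    have "real a = (1 / (\<delta> * ln 2)) * (real a * (\<delta> * ln 2))" using \<delta> by simp
    also have "\<dots> \<le> M * (real a * (\<delta> * ln 2))" using \<delta> by (intro mult_right_mono) (auto simp: M_def)
    finally have "real a + 1 \<le> M * (1 + real a * (\<delta> * ln 2))" using M1 by (simp add: distrib_left)
    also have "\<dots> \<le> M * real p powr (real a * \<delta>)" using e M1 by (intro mult_left_mono) auto
    finally show ?thesis .
  qed
  have large: "real a + 1 \<le> real p powr (real a * \<delta>)" if "p \<ge> P" for a p :: nat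
  proof -
    have "2 powr (1/\<delta>) \<le> real p" using that unfolding P_def by linarith
    then have "(2 powr (1/\<delta>)) powr \<delta> \<le> real p powr \<delta>" using \<delta> by (intro powr_mono2) auto
    then have two: "2 \<le> real p powr \<delta>" using \<delta> by (simp add: powr_powr)
    have "real a + 1 \<le> 2 ^ a"
      by (induction a) auto
    also have "\<dots> \<le> (real p powr \<delta>) ^ a" using two by (intro power_mono) auto
    also have "\<dots> = real p powr (real a * \<delta>)"
      using two by (cases "p = 0") (simp_all add: powr_powr mult.commute flip: powr_realpow)
    finally show ?thesis .
  qed
  have "real (card {d. d dvd n}) \<le> M ^ P * real n powr \<delta>" if n: "n > 0" for n :: nat
  proof -
    let ?m = "\<lambda>p. multiplicity p n"
    have "real (card {d. d dvd n}) \<le> real (\<Prod>p\<in>prime_factors n. ?m p + 1)"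
      using card_divisors_le[OF n] of_nat_le_iff by blast
    also have "\<dots> = (\<Prod>p\<in>prime_factors n. real (?m p) + 1)" by (simp add: add.commute)
    also have "\<dots> \<le> (\<Prod>p\<in>prime_factors n. (if p < P then M else 1) * (real p powr (real (?m p) * \<delta>)))"
      using small large by (intro prod_mono) (auto simp: in_prime_factors_iff prime_ge_2_nat not_less)
    also have "\<dots> = (\<Prod>p\<in>prime_factors n. if p < P then M else 1) * (\<Prod>p\<in>prime_factors n. real p powr (real (?m p) * \<delta>))"
      by (rule prod.distrib)
    also have "(\<Prod>p\<in>prime_factors n. real p powr (real (?m p) * \<delta>)) = (\<Prod>p\<in>prime_factors n. (real p ^ ?m p) powr \<delta>)"
      by (intro prod.cong refl) (auto simp: in_prime_factors_iff prime_gt_0_nat powr_powr simp flip: powr_realpow)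
    also have "\<dots> = (\<Prod>p\<in>prime_factors n. real p ^ ?m p) powr \<delta>"
      by (rule prod_powr_distrib[symmetric])
    also have "(\<Prod>p\<in>prime_factors n. real p ^ ?m p) = real (\<Prod>p\<in>prime_factors n. p ^ ?m p)"
      by (simp only: of_nat_prod of_nat_power)
    also have "(\<Prod>p\<in>prime_factors n. p ^ ?m p) = n"
      using n by (subst prime_factorization_nat[symmetric]) auto
    also have "(\<Prod>p\<in>prime_factors n. if p < P then M else 1) = M ^ card {p\<in>prime_factors n. p < P}"
      by (simp add: prod.If_cases Int_def)
    also have "M ^ card {p\<in>prime_factors n. p < P} * real n powr \<delta> \<le> M ^ P * real n powr \<delta>"
    proof (intro mult_right_mono power_increasing)
      have "card {p\<in>prime_factors n. p < P} \<le> card {..<P}" by (intro card_mono) auto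
      then show "card {p\<in>prime_factors n. p < P} \<le> P" by simp
    qed (use M1 in auto)
    finally show ?thesis .
  qed
  then show ?thesis using M1 by (intro exI[of _ "M ^ P"]) auto
qed

text \<open>The sum is split at sqrt n. Below it, gcd \<le> n' \<le> sqrt n, so at most sqrt n terms
  of size at most 1/sqrt n occur. Above it, n'^-\<eta> \<le> n^(-\<eta>/2), while the sum of the
  gcds is at most n times the number of divisors of n.\<close>

lemma sum_gcd_powr_le:
  fixes \<eta> :: real
  assumes \<eta>: "\<eta> > 0"
  shows "\<exists>K\<ge>0. \<forall>n>0. (\<Sum>n'=1..n. real (gcd n n') / real n * real n' powr (-\<eta>)) \<le> K"
proof -
  \<comment> \<open>The exponent \<eta>/2 is exactly what the factor n^(-\<eta>/2) of the upper
    range cancels.\<close>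
  obtain K where K: "K > 0" "\<And>n. n > 0 \<Longrightarrow> real (card {d. d dvd n}) \<le> K * real n powr (\<eta>/2)"
    using divisor_bound[of "\<eta>/2"] \<eta> by auto
  have "(\<Sum>n'=1..n. real (gcd n n') / real n * real n' powr (-\<eta>)) \<le> 1 + K" if n: "n > 0" for n :: nat
  proof -
    have "(\<Sum>n'=1..n. real (gcd n n') / real n * real n' powr (-\<eta>))
      \<le> (\<Sum>n'=1..n. (if real n' \<le> sqrt n then 1 / sqrt n else 0) + real (gcd n n') * (1 / real n * real n powr (-\<eta>/2)))"
    proof (rule sum_mono)
      fix n' assume n': "n' \<in> {1..n}"
      show "real (gcd n n') / real n * real n' powr (-\<eta>) \<le> (if real n' \<le> sqrt n then 1 / sqrt n else 0) + real (gcd n n') * (1 / real n * real n powr (-\<eta>/2))"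
      proof (cases "real n' \<le> sqrt n")
        case True
        have "gcd n n' \<le> n'" using n' by (intro dvd_imp_le) auto
        then have "real (gcd n n') \<le> sqrt n" using True by linarith
        then have "real (gcd n n') / real n \<le> sqrt n / n" by (intro divide_right_mono) auto
        also have "\<dots> = 1 / sqrt n" by (simp add: real_div_sqrt inverse_eq_divide sqrt_divide_self_eq)
        finally have "real (gcd n n') / real n * real n' powr (-\<eta>) \<le> 1 / sqrt n * 1"
          using n' \<eta> by (intro mult_mono) (auto intro!: powr_le1 simp: powr_minus_divide ge_one_powr_ge_zero)
        moreover have "0 \<le> real (gcd n n') * (1 / real n * real n powr (-\<eta>/2))" by simp
        ultimately show ?thesis using True by (simp only: if_True)
      next
        case False
        have "real n' powr (-\<eta>) \<le> sqrt n powr (-\<eta>)"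
          using False n n' \<eta> by (intro powr_mono2') auto
        also have "\<dots> = real n powr (-\<eta>/2)" using n by (simp add: powr_powr flip: powr_half_sqrt)
        finally have "real (gcd n n') / real n * real n' powr (-\<eta>) \<le> real (gcd n n') / real n * real n powr (-\<eta>/2)"
          by (intro mult_left_mono) auto
        then show ?thesis using False by simp
      qed
    qed
    also have "\<dots> = (\<Sum>n'=1..n. if real n' \<le> sqrt n then 1 / sqrt n else 0) + (\<Sum>n'=1..n. real (gcd n n')) * (1 / real n * real n powr (-\<eta>/2))"
      by (simp only: sum.distrib sum_distrib_right)
    finally have main: "(\<Sum>n'=1..n. real (gcd n n') / real n * real n' powr (-\<eta>)) \<le> (\<Sum>n'=1..n. if real n' \<le> sqrt n then 1 / sqrt n else 0) + (\<Sum>n'=1..n. real (gcd n n')) * (1 / real n * real n powr (-\<eta>/2))" .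
    have small: "(\<Sum>n'=1..n. if real n' \<le> sqrt n then 1 / sqrt n else 0) \<le> 1"
    proof -
      have "(\<Sum>n'=1..n. if real n' \<le> sqrt n then 1 / sqrt n else 0) = real (card {n' \<in> {1..n}. real n' \<le> sqrt n}) / sqrt n"
        by (simp add: sum.If_cases Int_def)
      also have "card {n' \<in> {1..n}. real n' \<le> sqrt n} \<le> card {1..nat \<lfloor>sqrt n\<rfloor>}"
        by (intro card_mono) (auto simp: le_nat_iff le_floor_iff)
      then have "real (card {n' \<in> {1..n}. real n' \<le> sqrt n}) \<le> real (nat \<lfloor>sqrt n\<rfloor>)"
        by (subst of_nat_le_iff) simp
      also have "\<dots> \<le> sqrt n" by simp
      finally show ?thesis using n by (simp add: divide_right_mono)
    qed
    have gcd_sum: "(\<Sum>n'=1..n. real (gcd n n')) \<le> real n * real (card {d. d dvd n})"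
    proof -
      have "(\<Sum>n'=1..n. real (gcd n n')) \<le> (\<Sum>d | d dvd n. real d * real (n div d))"
        using sum_gcd_le[OF n, of real] by simp
      also have "\<dots> = (\<Sum>d | d dvd n. real n)" by (intro sum.cong refl) (auto simp flip: of_nat_mult)
      finally show ?thesis by (simp add: mult.commute)
    qed
    have "(\<Sum>n'=1..n. real (gcd n n')) * (1 / real n * real n powr (-\<eta>/2))
       \<le> real n * real (card {d. d dvd n}) * (1 / real n * real n powr (-\<eta>/2))"
      using gcd_sum by (intro mult_right_mono) auto
    also have "real n * real (card {d. d dvd n}) * (1 / real n * real n powr (-\<eta>/2))
       = real (card {d. d dvd n}) * real n powr (-\<eta>/2)" using n by simp
    also have "\<dots> \<le> K * real n powr (\<eta>/2) * real n powr (-\<eta>/2)"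
      using K(2)[OF n] by (intro mult_right_mono) auto
    also have "\<dots> = K" using n by (simp add: mult.assoc flip: powr_add)
    finally have "(\<Sum>n'=1..n. real (gcd n n')) * (1 / real n * real n powr (-\<eta>/2)) \<le> K" .
    then show ?thesis using main small by linarith
  qed
  then show ?thesis using K by (intro exI[of _ "1 + K"]) auto
qed

section \<open>Periodic sets and translations of the torus\<close>

text \<open>Lattice vectors are parametrised by integer functions, so that counting and congruences
  take place in \<open>int\<close>; the range is \<open>int_lattice\<close>.\<close>

definition int_vec :: "('k::finite \<Rightarrow> int) \<Rightarrow> real ^ 'k"
  where "int_vec c = (\<chi> j. of_int (c j))"

definition unit_cube :: "(real ^ 'k::finite) set"
  where "unit_cube = {x. \<forall>j. 0 \<le> x $ j \<and> x $ j < 1}"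

lemma int_vec_nth [simp]: "int_vec c $ j = of_int (c j)"
  by (simp add: int_vec_def)

lemma measurable_vec_nth_real [measurable]: "(\<lambda>x::real^'k::finite. x $ j) \<in> borel_measurable borel"
  by (intro borel_measurable_continuous_onI continuous_intros)

lemma unit_cube_borel [measurable]: "unit_cube \<in> sets borel"
  unfolding unit_cube_def by measurable

lemma emeasure_unit_cube_finite:
  fixes S :: "(real^'k::finite) set"
  shows "emeasure lborel (unit_cube \<inter> S) < \<infinity>"
proof -
  have "(unit_cube :: (real^'k::finite) set) \<subseteq> cbox 0 1"
    by (auto simp: unit_cube_def mem_box_cart less_imp_le)
  then have "unit_cube \<inter> S \<subseteq> cbox 0 1" by blast
  then have "emeasure lborel (unit_cube \<inter> S) \<le> emeasure lborel (cbox 0 1 :: (real^'k) set)"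
    by (rule emeasure_mono) simp
  also have "\<dots> < \<infinity>"
    by (rule emeasure_lborel_cbox_finite)
  finally show ?thesis .
qed

text \<open>The half-open cube holds exactly one representative of each class modulo the lattice.
  This uniqueness turns the pieces cut out by lattice translations into partitions.\<close>

lemma minus_int_vec_in_unit_cube_iff: "y - int_vec c \<in> unit_cube \<longleftrightarrow> c = (\<lambda>j. \<lfloor>y $ j\<rfloor>)"
  proof -
  have "0 \<le> y $ j - of_int (c j) \<and> y $ j - of_int (c j) < 1 \<longleftrightarrow> c j = \<lfloor>y $ j\<rfloor>" for j
    using floor_eq_iff[of "y $ j" "c j"] by linarith
  then show ?thesis by (simp add: unit_cube_def fun_eq_iff)
qed

lemma emeasure_lborel_translate:
  fixes S :: "'a::euclidean_space set"
  assumes "S \<in> sets borel"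
  shows "emeasure lborel {x. x + v \<in> S} = emeasure lborel S"
proof -
  have "emeasure lborel S = emeasure (distr lborel borel ((+) v)) S"
    by (simp add: lborel_distr_plus)
  also have "\<dots> = emeasure lborel ((+) v -` S)"
    using assms by (subst emeasure_distr) auto
  also have "(+) v -` S = {x. x + v \<in> S}"
    by (auto simp: add.commute)
  finally show ?thesis by simp
qed

text \<open>Translation by \<open>v\<close> preserves Lebesgue measure on the torus: the cube is cut
  into countably many pieces according to the lattice vector that brings the translated point back,
  and each piece is moved rigidly.\<close>

lemma measure_periodic_translate:
  fixes S :: "(real^'k::finite) set"
  assumes S [measurable]: "S \<in> sets borel" and per: "\<And>x c. x + int_vec c \<in> S \<longleftrightarrow> x \<in> S"
  shows "measure lborel (unit_cube \<inter> {x. x + v \<in> S}) = measure lborel (unit_cube \<inter> S)"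
proof -
  \<comment> \<open>\<open>E c\<close> collects the points whose translate returns to the cube by
    subtracting \<open>c\<close>, and \<open>F c\<close> is its image under translation by
    \<open>v - int_vec c\<close>. Both families are partitions, indexed by floors.\<close>
  define E where "E = (\<lambda>c::'k\<Rightarrow>int. (unit_cube \<inter> {x. x + v \<in> S}) \<inter> {x. (x + v) - int_vec c \<in> unit_cube})"
  define F where "F = (\<lambda>c::'k\<Rightarrow>int. (unit_cube \<inter> S) \<inter> {x. x - v + int_vec c \<in> unit_cube})"
  have [measurable]: "E c \<in> sets borel" "F c \<in> sets borel" for c
    unfolding E_def F_def by measurable
  have per': "x - int_vec c \<in> S \<longleftrightarrow> x \<in> S" for x c
    using per[of "x - int_vec c" c] by simp
  have "E c = {x. x + (v - int_vec c) \<in> F c}" for c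
    using per'[of "_ + v"] by (auto simp: E_def F_def add_diff_eq)
  then have EF: "emeasure lborel (E c) = emeasure lborel (F c)" for c
    by (simp add: emeasure_lborel_translate)
  have neg: "int_vec (\<lambda>j. - c j) = - int_vec c" for c :: "'k \<Rightarrow> int"
    by (simp add: vec_eq_iff)
  have plus: "y + int_vec c \<in> unit_cube \<longleftrightarrow> c = (\<lambda>j. - \<lfloor>y $ j\<rfloor>)" for y and c :: "'k \<Rightarrow> int"
    using minus_int_vec_in_unit_cube_iff[of y "\<lambda>j. - c j"] 
    by (simp add: neg fun_eq_iff) (metis minus_minus)
  have dE: "disjoint_family_on E UNIV"
    by (auto simp: disjoint_family_on_def E_def minus_int_vec_in_unit_cube_iff)
  have dF: "disjoint_family_on F UNIV"
    by (auto simp: disjoint_family_on_def F_def plus)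
  have uE: "(\<Union>c\<in>UNIV. E c) = unit_cube \<inter> {x. x + v \<in> S}"
    by (auto simp: E_def minus_int_vec_in_unit_cube_iff)
  have uF: "(\<Union>c\<in>UNIV. F c) = unit_cube \<inter> S"
    by (auto simp: F_def plus)
  have "emeasure lborel (unit_cube \<inter> {x. x + v \<in> S}) = emeasure lborel (unit_cube \<inter> S)"
    using emeasure_UN_countable[OF _ _ dE, of lborel] emeasure_UN_countable[OF _ _ dF, of lborel]
    by (simp add: uE uF EF)
  then show ?thesis by (simp add: measure_def)
qed

text \<open>Once divided by \<open>n\<close>, these are representatives of the n^k classes of the
  grid of mesh 1/n modulo the integer lattice.\<close>

definition index_box :: "nat \<Rightarrow> ('k::finite \<Rightarrow> int) set"
  where "index_box n = PiE UNIV (\<lambda>_. {0..<int n})"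

lemma finite_index_box [simp]: "finite (index_box n)"
  and card_index_box: "card (index_box n :: ('k::finite \<Rightarrow> int) set) = n ^ CARD('k)"
  by (simp_all add: index_box_def card_PiE finite_PiE)

text \<open>Translating by a grid vector c/n keeps the measure of \<open>S \<inter> S'\<close> and
  fixes \<open>S\<close>. Summing over all c and exchanging sum and integral leaves, for each x in
  \<open>S\<close>, the number of c with x + c/n in \<open>S'\<close>, which is at most
  \<open>B\<close>.\<close>

lemma overlap_averaging:
  fixes S S' :: "(real^'k::finite) set"
  assumes [measurable]: "S \<in> sets borel" "S' \<in> sets borel"
    and n: "n > 0"
    and per: "\<And>x c. x + (1 / real n) *\<^sub>R int_vec c \<in> S \<longleftrightarrow> x \<in> S"
    and per': "\<And>x c. x + int_vec c \<in> S' \<longleftrightarrow> x \<in> S'"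
    and B: "\<And>x. real (card {c \<in> index_box n. x + (1 / real n) *\<^sub>R int_vec c \<in> S'}) \<le> B"
  shows "real n ^ CARD('k) * measure lborel (unit_cube \<inter> S \<inter> S') \<le> B * measure lborel (unit_cube \<inter> S)"
proof -
  let ?v = "\<lambda>c. (1 / real n) *\<^sub>R int_vec c"
  have perS: "x + int_vec c \<in> S \<longleftrightarrow> x \<in> S" for x c
  proof -
    have "int_vec c = ?v (\<lambda>j. int n * c j)" using n by (simp add: vec_eq_iff)
    then show ?thesis using per[of x "\<lambda>j. int n * c j"] by simp
  qed
  have fin: "emeasure lborel (unit_cube \<inter> X) = ennreal (measure lborel (unit_cube \<inter> X))" for X :: "(real^'k) set"
    using emeasure_unit_cube_finite[of X] by (intro emeasure_eq_ennreal_measure) auto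
  have B0: "B \<ge> 0" using B[of 0] by (meson of_nat_0_le_iff order_trans)
  have one: "measure lborel (unit_cube \<inter> (S \<inter> S')) = measure lborel (unit_cube \<inter> {x. x + ?v c \<in> S \<inter> S'})" for c
    by (rule measure_periodic_translate[symmetric]) (auto simp: perS per')
  \<comment> \<open>In \<open>ennreal\<close> the sum and the integral commute without integrability
    conditions; finite measure on the cube allows the return to reals.\<close>
  have "ennreal (real n ^ CARD('k) * measure lborel (unit_cube \<inter> (S \<inter> S'))) =
     (\<Sum>c\<in>(index_box n :: ('k \<Rightarrow> int) set). ennreal (measure lborel (unit_cube \<inter> (S \<inter> S'))))"
    by (subst sum_ennreal) (auto simp: card_index_box)
  also have "\<dots> = (\<Sum>c\<in>index_box n. emeasure lborel (unit_cube \<inter> {x. x + ?v c \<in> S \<inter> S'}))"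
    by (intro sum.cong refl) (metis fin one)
  also have "\<dots> = (\<Sum>c\<in>index_box n. \<integral>\<^sup>+x. indicator (unit_cube \<inter> S) x * indicator {x. x + ?v c \<in> S'} x \<partial>lborel)"
  proof (rule sum.cong[OF refl])
    fix c :: "'k \<Rightarrow> int"
    have "emeasure lborel (unit_cube \<inter> {x. x + ?v c \<in> S \<inter> S'}) =
      (\<integral>\<^sup>+x. indicator (unit_cube \<inter> {x. x + ?v c \<in> S \<inter> S'}) x \<partial>lborel)"
      by (rule nn_integral_indicator[symmetric]) measurable
    also have "\<dots> = (\<integral>\<^sup>+x. indicator (unit_cube \<inter> S) x * indicator {x. x + ?v c \<in> S'} x \<partial>lborel)"
      by (intro nn_integral_cong) (auto simp: indicator_def per)
    finally show "emeasure lborel (unit_cube \<inter> {x. x + ?v c \<in> S \<inter> S'}) = \<dots>" .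
  qed
  also have "\<dots> = (\<integral>\<^sup>+x. (\<Sum>c\<in>index_box n. indicator (unit_cube \<inter> S) x * indicator {x. x + ?v c \<in> S'} x) \<partial>lborel)"
    by (rule nn_integral_sum[symmetric]) measurable
  also have "\<dots> \<le> (\<integral>\<^sup>+x. ennreal B * indicator (unit_cube \<inter> S) x \<partial>lborel)"
  proof (rule nn_integral_mono)
    fix x :: "real^'k"
    have count: "(\<Sum>c\<in>index_box n. indicator {x. x + ?v c \<in> S'} x :: ennreal) = of_nat (card {c \<in> index_box n. x + ?v c \<in> S'})"
      unfolding card_eq_sum of_nat_sum sum.inter_filter[OF finite_index_box]
      by (intro sum.cong) (simp_all add: indicator_def)
    have "(\<Sum>c\<in>index_box n. indicator {x. x + ?v c \<in> S'} x :: ennreal) \<le> ennreal B"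
      unfolding count ennreal_of_nat_eq_real_of_nat by (rule ennreal_leI[OF B])
    then have "indicator (unit_cube \<inter> S) x * (\<Sum>c\<in>index_box n. indicator {x. x + ?v c \<in> S'} x :: ennreal)
      \<le> indicator (unit_cube \<inter> S) x * ennreal B" by (intro mult_left_mono) auto
    then show "(\<Sum>c\<in>index_box n. indicator (unit_cube \<inter> S) x * indicator {x. x + ?v c \<in> S'} x)
      \<le> ennreal B * indicator (unit_cube \<inter> S) x"
      by (simp add: sum_distrib_left mult.commute)
  qed
  also have "\<dots> = ennreal B * emeasure lborel (unit_cube \<inter> S)"
    by (rule nn_integral_cmult_indicator) measurable
  also have "\<dots> = ennreal (B * measure lborel (unit_cube \<inter> S))"
    using B0 by (simp add: fin ennreal_mult)
  finally show ?thesis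
    using B0 by (simp add: Int_assoc)
qed

section \<open>Lattice points in strongly star-shaped sets\<close>

text \<open>Since \<open>f\<close> is invertible modulo \<open>e\<close>, the condition fixes i
  modulo \<open>e\<close>, so i is determined by its quotient \<open>i div e\<close>, which has
  \<open>g\<close> possible values.\<close>

lemma card_congruence_solutions_le:
  fixes e f s :: int
  assumes e: "e > 0" and g: "g \<ge> 0" and cop: "coprime e f"
  shows "card {i \<in> {0..<g * e}. e dvd (i * f - s)} \<le> nat g"
proof -
  have "inj_on (\<lambda>i. i div e) {i \<in> {0..<g * e}. e dvd (i * f - s)}"
  proof (rule inj_onI)
    fix i i' assume i: "i \<in> {i \<in> {0..<g * e}. e dvd (i * f - s)}"
      and i': "i' \<in> {i \<in> {0..<g * e}. e dvd (i * f - s)}" and eq: "i div e = i' div e"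
    have "e dvd (i * f - s) - (i' * f - s)"
      using i i' by (metis (no_types, lifting) dvd_diff mem_Collect_eq)
    then have "e dvd (i - i') * f" by (simp add: algebra_simps)
    then have "e dvd i - i'" using cop by (simp add: coprime_dvd_mult_left_iff)
    then have "i mod e = i' mod e" by (simp add: mod_eq_dvd_iff)
    with eq show "i = i'" by (metis div_mult_mod_eq)
  qed
  moreover have "(\<lambda>i. i div e) ` {i \<in> {0..<g * e}. e dvd (i * f - s)} \<subseteq> {0..<g}"
  proof clarsimp
    fix i assume i: "0 \<le> i" "i < g * e"
    have "e * (i div e) \<le> i" using e by (simp add: minus_mod_eq_mult_div[symmetric])
    then have "e * (i div e) < e * g" using i by (simp add: mult.commute)
    then show "0 \<le> i div e \<and> i div e < g" using e i by (simp add: pos_imp_zdiv_nonneg_iff)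
  qed
  ultimately have "card {i \<in> {0..<g * e}. e dvd (i * f - s)} \<le> card {0..<g}"
    by (intro card_inj_on_le) auto
  then show ?thesis by simp
qed

text \<open>Write n = g e, n' = g f with e, f coprime, so that the lcm is L = g e f and c/n - b/n' =
  (c f - b e)/L. Each admissible c thus yields a point of the grid of mesh 1/L, and a given point
  arises from at most g values in each coordinate.\<close>

lemma card_shifted_lattice_le:
  fixes Z :: "(real^'k::finite) set" and n n' :: nat
  assumes n: "n > 0" and n': "n' > 0"
    and fin: "finite {s. u + (1 / real (lcm n n')) *\<^sub>R int_vec s \<in> Z}"
  shows "card {c \<in> index_box n. \<exists>b. u + (1 / real n) *\<^sub>R int_vec c - (1 / real n') *\<^sub>R int_vec b \<in> Z}
     \<le> gcd n n' ^ CARD('k) * card {s. u + (1 / real (lcm n n')) *\<^sub>R int_vec s \<in> Z}"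
proof -
  define g where "g = gcd n n'"
  obtain e f where ef: "n = g * e" "n' = g * f" "coprime e f"
    unfolding g_def using gcd_coprime_exists[of n n'] n by (metis mult.commute gcd_eq_0_iff neq0_conv)
  have pos: "g > 0" "e > 0" "f > 0" using n n' ef by auto
  have L: "lcm n n' = g * e * f"
    using ef by (simp add: lcm_mult_left lcm_coprime)
  let ?p = "\<lambda>c b. u + (1 / real n) *\<^sub>R int_vec c - (1 / real n') *\<^sub>R int_vec b :: real^'k"
  let ?C = "{c \<in> index_box n. \<exists>b. ?p c b \<in> Z}"
  let ?T = "{s. u + (1 / real (lcm n n')) *\<^sub>R int_vec s \<in> Z}"
  \<comment> \<open>One witness per \<open>c\<close> is enough, because the indices \<open>c\<close>
    are counted and not the pairs.\<close>
  define b where "b c = (SOME b. ?p c b \<in> Z)" for c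
  define s where "s c = (\<lambda>j. c j * int f - b c j * int e)" for c
  have b: "?p c (b c) \<in> Z" if "c \<in> ?C" for c
    using that unfolding b_def by (intro someI_ex[of "\<lambda>b. ?p c b \<in> Z"]) blast
  have ps: "?p c (b c) = u + (1 / real (lcm n n')) *\<^sub>R int_vec (s c)" for c
    unfolding L using pos by (simp add: vec_eq_iff s_def ef(1,2) field_simps)
  have sT: "s ` ?C \<subseteq> ?T" using b by (auto simp: ps)
  have fiber: "card {c \<in> ?C. s c = t} \<le> g ^ CARD('k)" for t
  proof -
    let ?R = "PiE UNIV (\<lambda>j. {i \<in> {0..<int g * int e}. int e dvd (i * int f - t j)})"
    \<comment> \<open>Equality of \<open>s c\<close> and \<open>t\<close> gives c_j f - t_j = b_j e,
      so \<open>e\<close> divides it in every coordinate separately.\<close>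
    have "{c \<in> ?C. s c = t} \<subseteq> ?R"
      by (auto simp: s_def index_box_def ef(1))
    then have "card {c \<in> ?C. s c = t} \<le> card ?R"
      by (intro card_mono finite_PiE finite_subset[OF Collect_restrict[of "{0..<int g * int e}"]]) simp_all
    also have "\<dots> = (\<Prod>j\<in>UNIV. card {i \<in> {0..<int g * int e}. int e dvd (i * int f - t j)})"
      by (simp add: card_PiE)
    also have "\<dots> \<le> (\<Prod>j\<in>(UNIV::'k set). g)"
      using card_congruence_solutions_le[of "int e" "int g" "int f"] pos ef(3)
      by (intro prod_mono) auto
    finally show ?thesis by simp
  qed
  have finC: "finite ?C" by simp
  have "card ?C = (\<Sum>t\<in>s ` ?C. card {c \<in> ?C. s c = t})"
    using sum.image_gen[OF finC, of "\<lambda>_. 1::nat" s] by simp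
  also have "\<dots> \<le> (\<Sum>t\<in>s ` ?C. g ^ CARD('k))" by (intro sum_mono fiber)
  also have "\<dots> \<le> card ?T * g ^ CARD('k)"
    using card_mono[OF fin sT] by simp
  finally show ?thesis by (simp add: g_def mult.commute)
qed

text \<open>This is the remainder (X+1)^k - X^k with X = 2T: all integer points of the cube less
  those with every coordinate nonzero. It equals 1 when T = 0.\<close>

lemma card_box_with_zero:
  "card {t::'k::finite \<Rightarrow> int. (\<forall>j. \<bar>t j\<bar> \<le> int T) \<and> (\<exists>j. t j = 0)} = (2 * T + 1) ^ CARD('k) - (2 * T) ^ CARD('k)"
proof -
  let ?A = "PiE UNIV (\<lambda>_::'k. {- int T..int T})"
  let ?B = "PiE UNIV (\<lambda>_::'k. {- int T..int T} - {0})"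
  have T2: "nat (2 * int T + 1) = 2 * T + 1" by simp
  have "{t::'k \<Rightarrow> int. (\<forall>j. \<bar>t j\<bar> \<le> int T) \<and> (\<exists>j. t j = 0)} = ?A - ?B"
    by (auto simp: abs_le_iff PiE_iff minus_le_iff)
  also have "card \<dots> = card ?A - card ?B"
    by (intro card_Diff_subset finite_PiE) auto
  also have "card ?A = (2 * T + 1) ^ CARD('k)"
    by (simp add: card_PiE T2)
  also have "card ?B = (2 * T) ^ CARD('k)"
    by (simp add: card_PiE T2)
  finally show ?thesis .
qed

text \<open>
  Attach to each lattice point with no vanishing index the cell of side \<open>1/L\<close> on its side facing
  the origin.  These cells are pairwise disjoint and, by star-shapedness, stay inside \<open>Z\<close>.
\<close>
lemma card_lattice_nonzero_le:
  fixes Z :: "(real^'k::finite) set" and L :: nat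
  assumes star: "strongly_star_shaped Z" and Z: "Z \<in> sets borel" "emeasure lborel Z < \<infinity>"
    and L: "L > 0" and v: "\<And>j. \<bar>v $ j\<bar> \<le> 1 / (2 * real L)"
    and S: "finite S" "\<And>t. t \<in> S \<Longrightarrow> v + (1 / real L) *\<^sub>R int_vec t \<in> Z" "\<And>t j. t \<in> S \<Longrightarrow> t j \<noteq> 0"
  shows "real (card S) \<le> real L ^ CARD('k) * measure lborel Z"
proof -
  \<comment> \<open>\<open>lo\<close> is the index of the lower face of the cell: [t-1, t] for
    positive t, [t, t+1] for negative t. With 0 excluded, different values of t have different
    \<open>lo\<close>, hence disjoint cells.\<close>
  define lo :: "('k \<Rightarrow> int) \<Rightarrow> 'k \<Rightarrow> int" where "lo t j = (if t j > 0 then t j - 1 else t j)" for t j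
  define W where "W t = {x::real^'k. \<forall>j. v $ j + lo t j / L < x $ j \<and> x $ j < v $ j + (lo t j + 1) / L}" for t
  have W_box: "W t = box (v + (1 / real L) *\<^sub>R int_vec (lo t)) (v + (1 / real L) *\<^sub>R int_vec (\<lambda>j. lo t j + 1))" for t
    by (auto simp: W_def mem_box_cart)
  have W_borel: "W t \<in> sets borel" for t by (simp add: W_box)
  have W_fin: "emeasure lborel (W t) \<noteq> \<infinity>" for t
    unfolding W_box using emeasure_lborel_box_finite less_irrefl by metis
  have content: "measure lborel (W t) = (1 / real L) ^ CARD('k)" for t
  proof -
    have "box (v + (1 / real L) *\<^sub>R int_vec (lo t)) (v + (1 / real L) *\<^sub>R int_vec (\<lambda>j. lo t j + 1)) \<noteq> {}"
      using L by (simp add: interval_ne_empty_cart divide_strict_right_mono)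
    then have "cbox (v + (1 / real L) *\<^sub>R int_vec (lo t)) (v + (1 / real L) *\<^sub>R int_vec (\<lambda>j. lo t j + 1)) \<noteq> {}"
      using box_subset_cbox by blast
    then have "measure lborel (W t) = (\<Prod>j\<in>(UNIV::'k set). (v + (1 / real L) *\<^sub>R int_vec (\<lambda>j. lo t j + 1)) $ j - (v + (1 / real L) *\<^sub>R int_vec (lo t)) $ j)"
      unfolding W_box by (subst content_cbox_cart[symmetric]) (auto simp: measure_def emeasure_lborel_box_eq emeasure_lborel_cbox_eq)
    then show ?thesis by (simp flip: diff_divide_distrib)
  qed
  have sub: "W t \<subseteq> Z" if t: "t \<in> S" for t
  proof
    fix x assume x: "x \<in> W t"
    have "\<bar>x $ j\<bar> \<le> \<bar>(v + (1 / real L) *\<^sub>R int_vec t) $ j\<bar>" for j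
    proof -
      have x': "v $ j + lo t j / L < x $ j" "x $ j < v $ j + (lo t j + 1) / L"
        using x by (auto simp: W_def)
      \<comment> \<open>Half a mesh is just enough: the cell of t \<ge> 1 ends at a point \<ge>
        \<open>h\<close> and starts at a point \<ge> \<open>-h\<close>, so its far end dominates in
        absolute value. The case t \<le> -1 is the mirror image.\<close>
      define h where "h = 1 / (2 * real L)"
      have h: "1 / real L = 2 * h" using L by (simp add: h_def)
      have v': "v $ j \<le> h" "- v $ j \<le> h" using v[of j] by (auto simp: h_def)
      consider "t j \<ge> 1" | "t j \<le> -1" using S(3)[OF t, of j] by linarith
      then have "\<bar>x $ j\<bar> \<le> \<bar>v $ j + t j / L\<bar>"
      proof cases
        case 1
        then have "1 / real L \<le> real_of_int (t j) / L" by (intro divide_right_mono) auto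
        moreover have "real_of_int (lo t j) / L = t j / L - 1 / L" "real_of_int (lo t j + 1) / L = t j / L"
          using 1 by (simp_all add: lo_def diff_divide_distrib)
        ultimately show ?thesis using x' v' unfolding h by linarith
      next
        case 2
        then have "real_of_int (t j) / L \<le> (- 1) / real L" by (intro divide_right_mono) auto
        then have "real_of_int (t j) / L \<le> - (1 / real L)" by simp
        moreover have "real_of_int (lo t j) / L = t j / L" "real_of_int (lo t j + 1) / L = t j / L + 1 / L"
          using 2 by (simp_all add: lo_def add_divide_distrib)
        ultimately show ?thesis using x' v' unfolding h by linarith
      qed
      then show ?thesis by simp
    qed
    then show "x \<in> Z"
      using star S(2)[OF t] unfolding strongly_star_shaped_def by blast
  qed
  have disj: "disjoint_family_on W S"
    unfolding disjoint_family_on_def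
  proof (intro ballI impI)
    fix t t' assume t: "t \<in> S" "t' \<in> S" "t \<noteq> t'"
    then obtain j where j: "t j \<noteq> t' j" by blast
    have "lo t j \<noteq> lo t' j"
      using j S(3)[OF t(1), of j] S(3)[OF t(2), of j] by (auto simp: lo_def split: if_splits)
    then have "lo t j + 1 \<le> lo t' j \<or> lo t' j + 1 \<le> lo t j" by linarith
    then have "(real_of_int (lo t j) + 1) / L \<le> lo t' j / L \<or> (real_of_int (lo t' j) + 1) / L \<le> lo t j / L"
      using L by (auto intro!: divide_right_mono)
    then show "W t \<inter> W t' = {}" by (auto simp: W_def dest!: spec[of _ j])
  qed
  have "real (card S) * (1 / real L) ^ CARD('k) = (\<Sum>t\<in>S. measure lborel (W t))"
    by (simp add: content)
  also have "\<dots> = measure lborel (\<Union>t\<in>S. W t)"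
    using S(1) disj W_borel W_fin
    by (intro measure_finite_Union[symmetric]) auto
  also have "\<dots> \<le> measure lborel Z"
    using sub Z S(1) W_borel by (intro measure_mono_fmeasurable fmeasurableI) auto
  finally have "real (card S) * (1 / real L) ^ CARD('k) \<le> measure lborel Z" .
  then show ?thesis using L by (simp add: field_simps power_divide)
qed

text \<open>Subtracting the grid point nearest to \<open>u\<close> leaves an offset of at most half
  a mesh. Points with no vanishing index are then counted by volume; the others have an index vector
  in a cube of radius \<open>T\<close> with some coordinate zero.\<close>

lemma card_lattice_points_le:
  fixes Z :: "(real^'k::finite) set" and L :: nat
  assumes star: "strongly_star_shaped Z" and Z: "Z \<in> sets borel"
    and L: "L > 0" and D: "\<And>z j. z \<in> Z \<Longrightarrow> \<bar>z $ j\<bar> \<le> D" "D \<ge> 0"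
    and T: "T = nat \<lfloor>2 * real L * D\<rfloor>"
  shows "finite {s. u + (1 / real L) *\<^sub>R int_vec s \<in> Z}"
    and "real (card {s. u + (1 / real L) *\<^sub>R int_vec s \<in> Z})
      \<le> real L ^ CARD('k) * measure lborel Z + real ((2 * T + 1) ^ CARD('k) - (2 * T) ^ CARD('k))"
proof -
  define r :: "'k \<Rightarrow> int" where "r j = round (real L * u $ j)" for j
  define v where "v = u - (1 / real L) *\<^sub>R int_vec r"
  have v: "\<bar>v $ j\<bar> \<le> 1 / (2 * real L)" for j
  proof -
    have "v $ j = (real L * u $ j - of_int (round (real L * u $ j))) / real L"
      using L by (simp add: v_def r_def field_simps)
    moreover have "\<bar>real L * u $ j - of_int (round (real L * u $ j))\<bar> \<le> 1 / 2"
      using of_int_round_abs_le[of "real L * u $ j"] by linarith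
    ultimately show ?thesis using L by (simp only: abs_divide) (simp add: field_simps)
  qed
  let ?V = "{t. v + (1 / real L) *\<^sub>R int_vec t \<in> Z}"
  have "bij_betw (\<lambda>s j. s j + r j) {s. u + (1 / real L) *\<^sub>R int_vec s \<in> Z} ?V"
  proof (rule bij_betwI[where g = "\<lambda>t j. t j - r j"])
    have *: "v + (1 / real L) *\<^sub>R int_vec (\<lambda>j. s j + r j) = u + (1 / real L) *\<^sub>R int_vec s"
      "u + (1 / real L) *\<^sub>R int_vec (\<lambda>j. s j - r j) = v + (1 / real L) *\<^sub>R int_vec s" for s
      by (simp_all add: vec_eq_iff v_def distrib_left right_diff_distrib add_divide_distrib diff_divide_distrib)
    show "(\<lambda>s j. s j + r j) \<in> {s. u + (1 / real L) *\<^sub>R int_vec s \<in> Z} \<rightarrow> ?V"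
      "(\<lambda>t j. t j - r j) \<in> ?V \<rightarrow> {s. u + (1 / real L) *\<^sub>R int_vec s \<in> Z}"
      by (auto simp: *)
  qed auto
  note bij = this
  \<comment> \<open>For a nonzero index the offset 1/(2L) is at most |t_j|/(2L) and is absorbed on
    the left. This is the source of the factor 2 in \<open>T\<close> and avoids an additive
    constant, so that \<open>T\<close> = 0 for small L D.\<close>
  have TT: "\<bar>t j\<bar> \<le> int T" if "t \<in> ?V" for t j
  proof (cases "t j = 0")
    case False
    have "\<bar>v $ j + t j / L\<bar> \<le> D" using D(1)[of "v + (1 / real L) *\<^sub>R int_vec t" j] that by simp
    then have "\<bar>t j / real L\<bar> \<le> D + 1 / (2 * real L)" using v[of j] by linarith
    also have "\<dots> \<le> D + \<bar>t j\<bar> / (2 * real L)"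
      using False L by (intro add_left_mono divide_right_mono) auto
    finally have "\<bar>real_of_int (t j)\<bar> \<le> 2 * real L * D"
      using L by (simp add: abs_divide field_simps)
    then have "\<bar>t j\<bar> \<le> \<lfloor>2 * real L * D\<rfloor>" by (simp add: le_floor_iff)
    then show ?thesis unfolding T by linarith
  qed simp
  have fin: "finite ?V"
  proof (rule finite_subset)
    show "?V \<subseteq> PiE UNIV (\<lambda>_. {- int T..int T})"
    proof
      fix t assume "t \<in> ?V"
      from TT[OF this] show "t \<in> PiE UNIV (\<lambda>_. {- int T..int T})"
        by (simp add: PiE_iff abs_le_iff minus_le_iff)
    qed
    show "finite (PiE (UNIV::'k set) (\<lambda>_. {- int T..int T}))" by (intro finite_PiE) auto
  qed
  then show "finite {s. u + (1 / real L) *\<^sub>R int_vec s \<in> Z}"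
    using bij_betw_finite[OF bij] by simp
  have "Z \<subseteq> cbox (\<chi> j. - D) (\<chi> j. D)"
    using D(1) by (auto simp: mem_box_cart abs_le_iff minus_le_iff)
  then have "emeasure lborel Z \<le> emeasure lborel (cbox (\<chi> j. - D) (\<chi> j. D) :: (real^'k) set)"
    by (rule emeasure_mono) simp
  also have "\<dots> < \<infinity>" by (rule emeasure_lborel_cbox_finite)
  finally have Zfin: "emeasure lborel Z < \<infinity>" .
  have V_split: "?V = {t \<in> ?V. \<forall>j. t j \<noteq> 0} \<union> {t \<in> ?V. \<exists>j. t j = 0}" by auto
  have "card ?V \<le> card {t \<in> ?V. \<forall>j. t j \<noteq> 0} + card {t \<in> ?V. \<exists>j. t j = 0}"
    by (rule order_trans[OF eq_refl[OF arg_cong[OF V_split, where f = card]] card_Un_le])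
  also have "{t \<in> ?V. \<exists>j. t j = 0} \<subseteq> {t. (\<forall>j. \<bar>t j\<bar> \<le> int T) \<and> (\<exists>j. t j = 0)}"
    using TT by auto
  then have "card {t \<in> ?V. \<exists>j. t j = 0} \<le> card {t::'k \<Rightarrow> int. (\<forall>j. \<bar>t j\<bar> \<le> int T) \<and> (\<exists>j. t j = 0)}"
  proof (rule card_mono[rotated])
    have "{t::'k \<Rightarrow> int. (\<forall>j. \<bar>t j\<bar> \<le> int T) \<and> (\<exists>j. t j = 0)} \<subseteq> PiE UNIV (\<lambda>_. {- int T..int T})"
      by (auto simp: PiE_iff abs_le_iff minus_le_iff)
    then show "finite {t::'k \<Rightarrow> int. (\<forall>j. \<bar>t j\<bar> \<le> int T) \<and> (\<exists>j. t j = 0)}"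
      by (rule finite_subset) (intro finite_PiE, auto)
  qed
  finally have "real (card ?V) \<le> real (card {t \<in> ?V. \<forall>j. t j \<noteq> 0}) + real ((2 * T + 1) ^ CARD('k) - (2 * T) ^ CARD('k))"
    unfolding card_box_with_zero by linarith
  also have "real (card {t \<in> ?V. \<forall>j. t j \<noteq> 0}) \<le> real L ^ CARD('k) * measure lborel Z"
    using fin by (intro card_lattice_nonzero_le[OF star Z Zfin L v]) auto
  finally show "real (card {s. u + (1 / real L) *\<^sub>R int_vec s \<in> Z})
      \<le> real L ^ CARD('k) * measure lborel Z + real ((2 * T + 1) ^ CARD('k) - (2 * T) ^ CARD('k))"
    using bij_betw_same_card[OF bij] by simp
qed

text \<open>In the binomial expansion of (q X + q)^k the top term cancels, the term l = 0 is q^k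
  \<le> q^3, and every other term contains at least one factor q and one factor q X, hence is at
  most a constant times q \<epsilon>.\<close>

lemma scaled_power_difference_le:
  fixes X q w :: real
  assumes q: "0 \<le> q" "q \<le> 1" and X: "0 \<le> X" "q * X \<le> c * \<epsilon>" and c: "0 \<le> c" "0 \<le> \<epsilon>" "\<epsilon> \<le> 1" and k: "k \<ge> 3"
  shows "q ^ k * ((X + 1) ^ k - X ^ k) \<le> q ^ 3 + (1 + c) ^ k * (q * \<epsilon>)"
proof -
  have "q ^ k * ((X + 1) ^ k - X ^ k) = (q * X + q) ^ k - (q * X) ^ k"
    by (simp add: right_diff_distrib flip: power_mult_distrib) (simp add: distrib_left)
  also have "(q * X + q) ^ k = (\<Sum>l\<le>k. of_nat (k choose l) * (q * X) ^ l * q ^ (k - l))"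
    by (rule binomial_ring)
  also have "\<dots> = (\<Sum>l<k. of_nat (k choose l) * (q * X) ^ l * q ^ (k - l)) + (q * X) ^ k"
    by (simp add: lessThan_Suc_atMost[symmetric])
  also have "\<dots> - (q * X) ^ k = (\<Sum>l<k. of_nat (k choose l) * (q * X) ^ l * q ^ (k - l))" by simp
  also have "\<dots> = q ^ k + (\<Sum>l=1..<k. of_nat (k choose l) * (q * X) ^ l * q ^ (k - l))"
    using k by (simp add: lessThan_atLeast0 sum.atLeast_Suc_lessThan)
  also have "q ^ k \<le> q ^ 3" using q k by (intro power_decreasing) auto
  also have "(\<Sum>l=1..<k. of_nat (k choose l) * (q * X) ^ l * q ^ (k - l))
     \<le> (\<Sum>l=1..<k. of_nat (k choose l) * (c ^ l * \<epsilon>) * q)"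
  proof (intro sum_mono mult_mono mult_nonneg_nonneg)
    fix l assume l: "l \<in> {1..<k}"
    have "(q * X) ^ l \<le> (c * \<epsilon>) ^ l" using q X by (intro power_mono) auto
    also have "\<dots> = c ^ l * \<epsilon> ^ l" by (rule power_mult_distrib)
    also have "\<epsilon> ^ l \<le> \<epsilon> ^ 1" using l c by (intro power_decreasing) auto
    finally show "(q * X) ^ l \<le> c ^ l * \<epsilon>" using c by (simp add: mult_left_mono)
    have "q ^ (k - l) \<le> q ^ 1" using l q by (intro power_decreasing) auto
    then show "q ^ (k - l) \<le> q" by simp
  qed (use q X c in auto)
  also have "\<dots> = (\<Sum>l=1..<k. of_nat (k choose l) * c ^ l) * (q * \<epsilon>)"
    by (simp add: sum_distrib_right sum_distrib_left mult_ac)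
  also have "\<dots> \<le> (\<Sum>l\<le>k. of_nat (k choose l) * c ^ l) * (q * \<epsilon>)"
    using q c by (intro mult_right_mono sum_mono2) auto
  also have "(\<Sum>l\<le>k. of_nat (k choose l) * c ^ l) = (c + 1) ^ k"
    using binomial_ring[of c 1 k] by simp
  finally show ?thesis by (simp add: add.commute)
qed

section \<open>Overlaps\<close>

text \<open>The translates of \<open>Z\<close> by the n^k grid vectors of \<open>index_box n\<close>
  are disjoint and, after a common shift, lie in the unit cube.\<close>

lemma measure_tile_le:
  fixes S Z :: "(real^'k::finite) set"
  assumes [measurable]: "S \<in> sets borel" "Z \<in> sets borel"
    and n: "n > 0"
    and S: "S = {x. \<exists>b. x - (1 / real n) *\<^sub>R int_vec b \<in> Z}"
    and per: "\<And>x c. x + int_vec c \<in> S \<longleftrightarrow> x \<in> S"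
    and Z: "\<And>z j. z \<in> Z \<Longrightarrow> \<bar>z $ j\<bar> < 1 / (2 * real n)"
  shows "real n ^ CARD('k) * measure lborel Z \<le> measure lborel (unit_cube \<inter> S)"
proof -
  \<comment> \<open>Cells centred at grid points straddle the boundary of the cube. A shift by half
    a mesh puts the one with index b strictly between b_j/n and (b_j + 1)/n in each coordinate, so b
    is read off by floors.\<close>
  define h :: "real^'k" where "h = (\<chi> j. 1 / (2 * real n))"
  let ?Q = "unit_cube \<inter> {x. x + (- h) \<in> S}"
  define X where "X b = {x. x + (- h - (1 / real n) *\<^sub>R int_vec b) \<in> Z}" for b
  have [measurable]: "X b \<in> sets borel" for b unfolding X_def by measurable
  have em: "emeasure lborel (X b) = emeasure lborel Z" for b
    unfolding X_def by (rule emeasure_lborel_translate) measurable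
  have fl: "b = (\<lambda>j. \<lfloor>real n * x $ j\<rfloor>)" if "x \<in> X b" for b x
  proof
    fix j
    have "\<bar>x $ j - 1 / (2 * real n) - b j / real n\<bar> < 1 / (2 * real n)"
      using Z[of "x + (- h - (1 / real n) *\<^sub>R int_vec b)" j] that by (simp add: X_def h_def)
    then have "real n * \<bar>x $ j - 1 / (2 * real n) - b j / real n\<bar> < 1 / 2"
      using n by (simp add: field_simps)
    moreover have "real n * \<bar>x $ j - 1 / (2 * real n) - b j / real n\<bar> = \<bar>real n * (x $ j - 1 / (2 * real n) - b j / real n)\<bar>"
      by (simp add: abs_mult)
    moreover have "real n * (x $ j - 1 / (2 * real n) - b j / real n) = real n * x $ j - 1 / 2 - b j"
      using n by (simp add: right_diff_distrib)
    ultimately have "\<bar>real n * x $ j - 1 / 2 - b j\<bar> < 1 / 2" by metis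
    then have "\<lfloor>real n * x $ j\<rfloor> = b j" unfolding floor_eq_iff by linarith
    then show "b j = \<lfloor>real n * x $ j\<rfloor>" by simp
  qed
  have sub: "X b \<subseteq> ?Q" if b: "b \<in> index_box n" for b
  proof
    fix x assume x: "x \<in> X b"
    have "0 \<le> x $ j \<and> x $ j < 1" for j
    proof -
      have "b j \<in> {0..<int n}" using b by (auto simp: index_box_def)
      then have "0 \<le> \<lfloor>real n * x $ j\<rfloor>" "\<lfloor>real n * x $ j\<rfloor> < int n" using fl[OF x] by auto
      then have "0 \<le> real n * x $ j" "real n * x $ j < real n"
        by (simp_all add: floor_less_iff)
      then show ?thesis using n by (simp add: zero_le_mult_iff)
    qed
    then have "x \<in> unit_cube" by (simp add: unit_cube_def)
    moreover have "x + (- h) \<in> S" using x by (auto simp: S X_def algebra_simps)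
    ultimately show "x \<in> ?Q" by simp
  qed
  have disj: "disjoint_family_on X (index_box n)"
    unfolding disjoint_family_on_def using fl by blast
  have "measure lborel (X b) = measure lborel Z" for b by (simp add: measure_def em)
  moreover have Xfin: "emeasure lborel (X b) \<noteq> \<infinity>" if b: "b \<in> index_box n" for b
  proof -
    have "emeasure lborel (X b) \<le> emeasure lborel ?Q"
      by (rule emeasure_mono[OF sub[OF b]]) measurable
    then show ?thesis using emeasure_unit_cube_finite[of "{x. x + (- h) \<in> S}"] by (auto simp: top_unique)
  qed
  ultimately have "real n ^ CARD('k) * measure lborel Z = (\<Sum>b\<in>(index_box n :: ('k \<Rightarrow> int) set). measure lborel (X b))"
    by (simp add: card_index_box)
  also have "\<dots> = measure lborel (\<Union>b\<in>index_box n. X b)"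
    using disj Xfin by (intro measure_finite_Union[symmetric]) auto
  also have "\<dots> \<le> measure lborel ?Q"
    using sub emeasure_unit_cube_finite[of "{x. x + (- h) \<in> S}"]
    by (intro measure_mono_fmeasurable fmeasurableI sets.finite_UN) auto
  also have "\<dots> = measure lborel (unit_cube \<inter> S)"
    by (rule measure_periodic_translate) (auto simp: per)
  finally show ?thesis .
qed

lemma lattice_fill_periodic:
  assumes "S = {x. \<exists>b. x - (1 / real n) *\<^sub>R int_vec b \<in> Z}"
  shows "x + (1 / real n) *\<^sub>R int_vec c \<in> S \<longleftrightarrow> x \<in> S"
proof -
  have "x + (1 / real n) *\<^sub>R int_vec c - (1 / real n) *\<^sub>R int_vec (\<lambda>j. b j + c j) = x - (1 / real n) *\<^sub>R int_vec b"
    "x - (1 / real n) *\<^sub>R int_vec (\<lambda>j. b j - c j) = x + (1 / real n) *\<^sub>R int_vec c - (1 / real n) *\<^sub>R int_vec b" for b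
    by (simp_all add: vec_eq_iff add_divide_distrib diff_divide_distrib)
  then show ?thesis unfolding assms mem_Collect_eq by metis
qed

lemma int_periodic:
  assumes n: "n > 0" and per: "\<And>x c. x + (1 / real n) *\<^sub>R int_vec c \<in> S \<longleftrightarrow> x \<in> S"
  shows "x + int_vec c \<in> S \<longleftrightarrow> x \<in> S"
proof -
  have "int_vec c = (1 / real n) *\<^sub>R int_vec (\<lambda>j. int n * c j)" using n by (simp add: vec_eq_iff)
  then show ?thesis using per[of x "\<lambda>j. int n * c j"] by simp
qed

text \<open>\<open>S\<close> serves only for averaging, \<open>S'\<close> for counting. After
  division by n^k the count splits into a main and an error term: since g^k L^k = n^k n'^k, the main
  one is n'^k \<lambda>(Z), at most the measure of \<open>S'\<close> on the torus, so no constant is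
  lost.\<close>

lemma overlap_le:
  fixes S S' Z :: "(real^'k::finite) set"
  assumes S: "S \<in> sets borel" "\<And>x c. x + (1 / real n) *\<^sub>R int_vec c \<in> S \<longleftrightarrow> x \<in> S"
    and S': "S' \<in> sets borel" "S' = {x. \<exists>b. x - (1 / real n') *\<^sub>R int_vec b \<in> Z}"
    and Z: "Z \<in> sets borel" "strongly_star_shaped Z" "\<And>z j. z \<in> Z \<Longrightarrow> \<bar>z $ j\<bar> < 1 / (2 * real n')"
    and D: "\<And>z j. z \<in> Z \<Longrightarrow> \<bar>z $ j\<bar> \<le> D" "D \<ge> 0"
    and n: "n > 0" "n' > 0"
    and X: "X = 2 * real (nat \<lfloor>2 * real (lcm n n') * D\<rfloor>)"
  shows "measure lborel (unit_cube \<inter> S \<inter> {x. x - \<gamma> \<in> S'})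
    \<le> measure lborel (unit_cube \<inter> S) * measure lborel (unit_cube \<inter> S')
      + measure lborel (unit_cube \<inter> S) * ((real (gcd n n') / real n) ^ CARD('k) * ((X + 1) ^ CARD('k) - X ^ CARD('k)))"
proof -
  let ?k = "CARD('k)"
  define T where "T = nat \<lfloor>2 * real (lcm n n') * D\<rfloor>"
  define R where "R = (X + 1) ^ ?k - X ^ ?k"
  have R: "real ((2 * T + 1) ^ ?k - (2 * T) ^ ?k) = R"
  proof (subst of_nat_diff)
    show "(2 * T) ^ ?k \<le> (2 * T + 1) ^ ?k" by (rule power_mono) simp_all
    show "real ((2 * T + 1) ^ ?k) - real ((2 * T) ^ ?k) = R"
      by (simp add: R_def X T_def add.commute)
  qed
  have L: "lcm n n' > 0" using n by (simp add: lcm_pos_nat)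
  note S'_per = lattice_fill_periodic[OF S'(2)]
  note S'_int = int_periodic[OF n(2) S'_per]
  define B where "B = real (gcd n n') ^ ?k * (real (lcm n n') ^ ?k * measure lborel Z + R)"
  have count: "real (card {c \<in> index_box n. x + (1 / real n) *\<^sub>R int_vec c \<in> {x. x - \<gamma> \<in> S'}}) \<le> B" for x
  proof -
    note points = card_lattice_points_le[OF Z(2,1) L D T_def, of "x - \<gamma>"]
    have "{c \<in> index_box n. x + (1 / real n) *\<^sub>R int_vec c \<in> {x. x - \<gamma> \<in> S'}}
      = {c \<in> index_box n. \<exists>b. (x - \<gamma>) + (1 / real n) *\<^sub>R int_vec c - (1 / real n') *\<^sub>R int_vec b \<in> Z}"
      unfolding S'(2) by (simp add: algebra_simps)
    then have "card {c \<in> index_box n. x + (1 / real n) *\<^sub>R int_vec c \<in> {x. x - \<gamma> \<in> S'}}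
      \<le> gcd n n' ^ ?k * card {s. (x - \<gamma>) + (1 / real (lcm n n')) *\<^sub>R int_vec s \<in> Z}"
      using card_shifted_lattice_le[OF n points(1)] by simp
    then have "real (card {c \<in> index_box n. x + (1 / real n) *\<^sub>R int_vec c \<in> {x. x - \<gamma> \<in> S'}})
      \<le> real (gcd n n') ^ ?k * real (card {s. (x - \<gamma>) + (1 / real (lcm n n')) *\<^sub>R int_vec s \<in> Z})"
      by (simp flip: of_nat_power of_nat_mult)
    also have "\<dots> \<le> B"
      unfolding B_def by (intro mult_left_mono points(2)[unfolded R] zero_le_power of_nat_0_le_iff)
    finally show ?thesis .
  qed
  have "{x. x - \<gamma> \<in> S'} \<in> sets borel" using S'(1) by measurable
  moreover have "x + int_vec c \<in> {x. x - \<gamma> \<in> S'} \<longleftrightarrow> x \<in> {x. x - \<gamma> \<in> S'}" for x c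
    using S'_int[of "x - \<gamma>" c] by (simp add: algebra_simps)
  ultimately have "real n ^ ?k * measure lborel (unit_cube \<inter> S \<inter> {x. x - \<gamma> \<in> S'}) \<le> B * measure lborel (unit_cube \<inter> S)"
    by (intro overlap_averaging S n count)
  moreover have "B \<le> real n ^ ?k * (measure lborel (unit_cube \<inter> S') + (real (gcd n n') / real n) ^ ?k * R)"
  proof -
    have gcd_lcm: "real (gcd n n') ^ ?k * real (lcm n n') ^ ?k = real n ^ ?k * real n' ^ ?k"
      by (simp flip: power_mult_distrib of_nat_mult)
    have "B = real n ^ ?k * (real n' ^ ?k * measure lborel Z) + real (gcd n n') ^ ?k * R"
      unfolding B_def distrib_left mult.assoc[symmetric] gcd_lcm ..
    moreover have "real n ^ ?k * (real n' ^ ?k * measure lborel Z) \<le> real n ^ ?k * measure lborel (unit_cube \<inter> S')"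
      by (intro mult_left_mono measure_tile_le[OF S'(1) Z(1) n(2) S'(2) S'_int Z(3)]) auto
    moreover have "real n ^ ?k * ((real (gcd n n') / real n) ^ ?k * R) = real (gcd n n') ^ ?k * R"
      using n by (simp add: power_divide)
    ultimately show ?thesis
      unfolding distrib_left by linarith
  qed
  then have "B * measure lborel (unit_cube \<inter> S)
    \<le> real n ^ ?k * (measure lborel (unit_cube \<inter> S') + (real (gcd n n') / real n) ^ ?k * R) * measure lborel (unit_cube \<inter> S)"
    by (rule mult_right_mono) simp
  ultimately have "real n ^ ?k * measure lborel (unit_cube \<inter> S \<inter> {x. x - \<gamma> \<in> S'})
    \<le> real n ^ ?k * ((measure lborel (unit_cube \<inter> S') + (real (gcd n n') / real n) ^ ?k * R) * measure lborel (unit_cube \<inter> S))"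
    by (simp add: mult.assoc)
  then have "measure lborel (unit_cube \<inter> S \<inter> {x. x - \<gamma> \<in> S'})
    \<le> (measure lborel (unit_cube \<inter> S') + (real (gcd n n') / real n) ^ ?k * R) * measure lborel (unit_cube \<inter> S)"
    by (rule mult_left_le_imp_le) (use n in simp)
  then show ?thesis by (simp add: R_def algebra_simps)
qed

text \<open>Multiplying by g/n turns the lcm into n', since g L = n n'. Thus (g/n) X \<le> 4 C
  n'^-\<eta>, which supplies the parameters c = 4 C and \<epsilon> = n'^-\<eta> of the binomial
  estimate.\<close>

lemma overlap_error_le:
  fixes C \<eta> :: real
  assumes n: "n > 0" "n' > 0" and C: "C \<ge> 0" and \<eta>: "\<eta> \<ge> 0" and k: "k \<ge> 3"
    and X: "X = 2 * real (nat \<lfloor>2 * real (lcm n n') * (C * real n' powr (- (1 + \<eta>)))\<rfloor>)"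
  shows "(real (gcd n n') / real n) ^ k * ((X + 1) ^ k - X ^ k)
    \<le> (real (gcd n n') / real n) ^ 3 + (1 + 4 * C) ^ k * (real (gcd n n') / real n * real n' powr (- \<eta>))"
proof (rule scaled_power_difference_le)
  have "gcd n n' \<le> n" using n by (intro dvd_imp_le) auto
  then show "real (gcd n n') / real n \<le> 1" using n by simp
  have D: "0 \<le> 2 * real (lcm n n') * (C * real n' powr (- (1 + \<eta>)))" using C by simp
  have "X \<le> 4 * real (lcm n n') * (C * real n' powr (- (1 + \<eta>)))"
    unfolding X using of_nat_floor[OF D] by linarith
  then have "real (gcd n n') / real n * X
    \<le> real (gcd n n') / real n * (4 * real (lcm n n') * (C * real n' powr (- (1 + \<eta>))))"
    by (rule mult_left_mono) simp
  also have "\<dots> = 4 * C * (real (gcd n n') * real (lcm n n') / real n * real n' powr (- (1 + \<eta>)))"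
    by simp
  also have "real (gcd n n') * real (lcm n n') = real n * real n'"
    by (simp flip: of_nat_mult)
  also have "real n * real n' / real n * real n' powr (- (1 + \<eta>)) = real n' powr 1 * real n' powr (- (1 + \<eta>))"
    using n by simp
  also have "\<dots> = real n' powr (- \<eta>)" unfolding powr_add[symmetric] by simp
  finally show "real (gcd n n') / real n * X \<le> 4 * C * real n' powr (- \<eta>)" .
  have "1 \<le> real n' powr \<eta>" using n \<eta> by (intro ge_one_powr_ge_zero) auto
  then show "real n' powr (- \<eta>) \<le> 1" by (simp add: powr_minus inverse_le_1_iff)
qed (use C k in \<open>simp_all add: X\<close>)

section \<open>Periodic form of homogeneous admissible sets\<close>

lemma nint_dist_add_of_int [simp]: "nint_dist (x + of_int a) = nint_dist x"
proof -
  have "round (x + of_int a) = \<lfloor>(x + 1 / 2) + of_int a\<rfloor>"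
    by (simp add: round_def algebra_simps)
  also have "\<dots> = round x + a"
    unfolding round_def by (rule floor_add_int[symmetric])
  finally have "round (x + of_int a) = round x + a" .
  then show ?thesis by (simp add: nint_dist_def)
qed

lemma nint_dist_le: "nint_dist x \<le> \<bar>x - of_int a\<bar>"
  unfolding nint_dist_def by (rule round_diff_minimal)

lemma nint_dist_eq_abs: "\<bar>x\<bar> < 1 / 2 \<Longrightarrow> nint_dist x = \<bar>x\<bar>"
  using round_unique'[of x 0] by (simp add: nint_dist_def)

lemma nint_dist_measurable [measurable]: "nint_dist \<in> borel_measurable borel"
  unfolding nint_dist_def round_def by measurable

lemma int_lattice_eq: "int_lattice = range int_vec"
proof (intro set_eqI iffI)
  fix a :: "real^'k" assume "a \<in> int_lattice"
  then have "a = int_vec (\<lambda>j. \<lfloor>a $ j\<rfloor>)"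
    by (simp add: int_lattice_def vec_eq_iff)
  then show "a \<in> range int_vec" by blast
qed (auto simp: int_lattice_def)

lemma torus_of_periodic:
  assumes "\<And>x c. x + int_vec c \<in> S \<longleftrightarrow> x \<in> S"
  shows "torus S = unit_cube \<inter> S"
  using assms by (auto simp: torus_def unit_cube_def int_lattice_eq)

lemma frac_vec_in_unit_cube: "x + int_vec (\<lambda>j. - \<lfloor>x $ j\<rfloor>) \<in> unit_cube"
  by (simp add: unit_cube_def) linarith

lemma ex_dyadic:
  assumes "n \<ge> 1"
  shows "\<exists>m\<ge>1. n \<in> dyadic m"
proof -
  obtain l where "2 ^ l \<le> n" "n < 2 ^ (l + 1)"
    using ex_power_ivl1[of 2 n] assms by auto
  then show ?thesis by (intro exI[of _ "l + 1"]) (simp add: dyadic_def)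
qed

text \<open>\<open>S\<close> is the periodic extension of \<open>A n\<close> and \<open>Z\<close>
  its part in the open cell around the origin. Star-shapedness has to be transferred to this
  \<open>Z\<close> from the unspecified set that property P provides.\<close>

lemma (in admissible_set_system) homogeneous_structure:
  assumes y0: "y = 0" and m: "1 \<le> m" "n \<in> dyadic m"
    and C: "\<And>i j. i \<in> I m \<Longrightarrow> d m i j \<le> D"
  shows "\<exists>S Z. S \<in> sets borel \<and> Z \<in> sets borel \<and> strongly_star_shaped Z
    \<and> (\<forall>z\<in>Z. \<forall>j. \<bar>z $ j\<bar> < 1 / (2 * real n) \<and> \<bar>z $ j\<bar> \<le> D)
    \<and> S = {x. \<exists>b. x - (1 / real n) *\<^sub>R int_vec b \<in> Z}
    \<and> (\<forall>\<gamma>. torus ((\<lambda>x. x + \<gamma>) ` A n) = unit_cube \<inter> {x. x - \<gamma> \<in> S})"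
proof -
  have n: "n > 0" using m by (auto simp: dyadic_def intro: less_le_trans[of 0 "2 ^ (m - 1)"])
  define S where "S = {x::real^'k. \<exists>i\<in>I m. \<forall>j. nint_dist (real n * x $ j) \<in> U m i j n}"
  define Z where "Z = S \<inter> {z. \<forall>j. \<bar>z $ j\<bar> < 1 / (2 * real n)}"
  \<comment> \<open>Right ends are excluded and n d \<le> 1/2, so distances to the nearest integer
    stay strictly below 1/2 on \<open>S\<close>, and the open cells of side 1/n cover it.\<close>
  have U_sub: "t < real n * d m i j" if "i \<in> I m" "t \<in> U m i j n" for i j t
    using U[OF m(1) that(1), of j] that(2) by auto
  have nd: "real n * d m i j \<le> 1 / 2" if "i \<in> I m" for i j
    using d_le[OF m(1) that m(2), of j] n by (simp add: field_simps)
  have U_borel [measurable]: "U m i j n \<in> sets borel" if "i \<in> I m" for i j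
    using U[OF m(1) that, of j] by auto
  have S_eq: "S = (\<Union>i\<in>I m. \<Inter>j. {x. nint_dist (real n * x $ j) \<in> U m i j n})"
    by (auto simp: S_def)
  have S_borel [measurable]: "S \<in> sets borel"
    unfolding S_eq
  proof (intro sets.finite_UN finite_I m sets.finite_INT)
    fix i j assume i: "i \<in> I m"
    have "(\<lambda>x::real^'k. nint_dist (real n * x $ j)) -` U m i j n \<inter> space borel \<in> sets borel"
      by (rule measurable_sets[OF _ U_borel[OF i]]) measurable
    then show "{x::real^'k. nint_dist (real n * x $ j) \<in> U m i j n} \<in> sets borel"
      by (simp add: vimage_def)
  qed auto
  have Z_borel: "Z \<in> sets borel" unfolding Z_def by measurable
  have S_per: "x + (1 / real n) *\<^sub>R int_vec c \<in> S \<longleftrightarrow> x \<in> S" for x c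
  proof -
    have "nint_dist (real n * (x + (1 / real n) *\<^sub>R int_vec c) $ j) = nint_dist (real n * x $ j)" for j
      using n by (simp add: distrib_left)
    then show ?thesis unfolding S_def mem_Collect_eq by simp
  qed
  note S_int = int_periodic[OF n S_per]
  have S_fill: "S = {x. \<exists>b. x - (1 / real n) *\<^sub>R int_vec b \<in> Z}"
  proof (intro set_eqI iffI)
    fix x assume x: "x \<in> S"
    then obtain i where i: "i \<in> I m" "\<And>j. nint_dist (real n * x $ j) \<in> U m i j n"
      by (auto simp: S_def)
    define b where "b j = round (real n * x $ j)" for j
    have "x - (1 / real n) *\<^sub>R int_vec b \<in> S"
      using S_per[of "x - (1 / real n) *\<^sub>R int_vec b" b] x by simp
    moreover have "\<bar>(x - (1 / real n) *\<^sub>R int_vec b) $ j\<bar> < 1 / (2 * real n)" for j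
    proof -
      have "real n * \<bar>(x - (1 / real n) *\<^sub>R int_vec b) $ j\<bar> = \<bar>real n * (x $ j - b j / n)\<bar>"
        by (simp add: abs_mult)
      also have "\<dots> = nint_dist (real n * x $ j)"
        using n by (simp add: nint_dist_def b_def right_diff_distrib)
      also have "\<dots> < 1 / 2" using U_sub[OF i] nd[OF i(1), of j] by (meson less_le_trans)
      finally show ?thesis using n by (simp add: field_simps)
    qed
    ultimately show "x \<in> {x. \<exists>b. x - (1 / real n) *\<^sub>R int_vec b \<in> Z}" by (auto simp: Z_def)
  next
    fix x assume "x \<in> {x. \<exists>b. x - (1 / real n) *\<^sub>R int_vec b \<in> Z}"
    then obtain b where "x - (1 / real n) *\<^sub>R int_vec b \<in> S" by (auto simp: Z_def)
    then show "x \<in> S" using S_per[of "x - (1 / real n) *\<^sub>R int_vec b" b] by simp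
  qed
  have A_eq: "A n = {x. (\<forall>j. 0 \<le> x $ j \<and> x $ j \<le> 1) \<and> x \<in> S}"
    unfolding A[OF m] S_def y0 by auto
  have torus_A: "torus ((\<lambda>x. x + \<gamma>) ` A n) = unit_cube \<inter> {x. x - \<gamma> \<in> S}" for \<gamma>
  proof (intro set_eqI iffI)
    fix x assume "x \<in> torus ((\<lambda>x. x + \<gamma>) ` A n)"
    then obtain c z where x: "x \<in> unit_cube" "x + int_vec c = z + \<gamma>" "z \<in> S"
      by (auto simp: torus_def unit_cube_def int_lattice_eq A_eq)
    then have "(x - \<gamma>) + int_vec c = z" by (simp add: algebra_simps)
    then show "x \<in> unit_cube \<inter> {x. x - \<gamma> \<in> S}" using x S_int[of "x - \<gamma>" c] by simp
  next
    fix x assume x: "x \<in> unit_cube \<inter> {x. x - \<gamma> \<in> S}"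
    \<comment> \<open>\<open>c\<close> brings x - \<gamma> into the half-open cube, where
      \<open>S\<close> and \<open>A n\<close> agree.\<close>
    define c where "c j = - \<lfloor>(x - \<gamma>) $ j\<rfloor>" for j
    have "(x - \<gamma>) + int_vec c \<in> unit_cube" unfolding c_def by (rule frac_vec_in_unit_cube)
    then have "(x - \<gamma>) + int_vec c \<in> A n"
      using x S_int[of "x - \<gamma>" c] by (auto simp: A_eq unit_cube_def less_imp_le)
    then have "x + int_vec c \<in> (\<lambda>x. x + \<gamma>) ` A n"
      by (rule rev_image_eqI) (simp add: algebra_simps)
    then show "x \<in> torus ((\<lambda>x. x + \<gamma>) ` A n)"
      using x by (auto simp: torus_def unit_cube_def int_lattice_eq)
  qed
  obtain Z0 where Z0: "strongly_star_shaped Z0"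
    "torus (A n) = torus {z + (1 / real n) *\<^sub>R (y + a) | z a. z \<in> Z0 \<and> a \<in> int_lattice}"
    using property_P[OF m] unfolding property_P_def by blast
  \<comment> \<open>Property P compares reductions modulo the lattice only; both \<open>S\<close>
    and \<open>P\<close> are periodic, so agreement on the unit cube is agreement
    everywhere.\<close>
  define P where "P = {x. \<exists>b. x - (1 / real n) *\<^sub>R int_vec b \<in> Z0}"
  have P_eq: "{z + (1 / real n) *\<^sub>R (y + a) | z a. z \<in> Z0 \<and> a \<in> int_lattice} = P"
  proof (intro set_eqI iffI)
    fix x assume "x \<in> {z + (1 / real n) *\<^sub>R (y + a) | z a. z \<in> Z0 \<and> a \<in> int_lattice}"
    then obtain z b where "x = z + (1 / real n) *\<^sub>R int_vec b" "z \<in> Z0"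
      by (auto simp: y0 int_lattice_eq)
    then have "x - (1 / real n) *\<^sub>R int_vec b \<in> Z0" by simp
    then show "x \<in> P" unfolding P_def by blast
  next
    fix x assume "x \<in> P"
    then obtain b where b: "x - (1 / real n) *\<^sub>R int_vec b \<in> Z0" unfolding P_def by blast
    have "x = (x - (1 / real n) *\<^sub>R int_vec b) + (1 / real n) *\<^sub>R (y + int_vec b)" by (simp add: y0)
    with b show "x \<in> {z + (1 / real n) *\<^sub>R (y + a) | z a. z \<in> Z0 \<and> a \<in> int_lattice}"
      unfolding int_lattice_eq by blast
  qed
  note P_int = int_periodic[OF n lattice_fill_periodic[OF P_def]]
  have "unit_cube \<inter> S = unit_cube \<inter> P"
    using torus_A[of 0] Z0(2) unfolding P_eq torus_of_periodic[OF P_int] by simp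
  then have SP: "x \<in> S \<longleftrightarrow> x \<in> P" for x
    using frac_vec_in_unit_cube[of x] S_int[of x] P_int[of x] by blast
  have "strongly_star_shaped Z"
    unfolding strongly_star_shaped_def
  proof (intro ballI allI impI)
    fix z w assume z: "z \<in> Z" and w: "\<forall>j. \<bar>w $ j\<bar> \<le> \<bar>z $ j\<bar>"
    obtain b where b: "z - (1 / real n) *\<^sub>R int_vec b \<in> Z0"
      using z SP by (auto simp: Z_def P_def)
    \<comment> \<open>The point of \<open>Z0\<close> that represents z may lie in another cell. But
      z lies in the central cell and is therefore coordinatewise smallest modulo 1/n, so the point
      of \<open>Z0\<close> dominates z and with it w.\<close>
    have "\<bar>z $ j\<bar> \<le> \<bar>(z - (1 / real n) *\<^sub>R int_vec b) $ j\<bar>" for j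
    proof -
      have "real n * \<bar>z $ j\<bar> < 1 / 2"
        using z n by (auto simp: Z_def field_simps)
      then have "real n * \<bar>z $ j\<bar> = nint_dist (real n * z $ j)"
        by (simp add: nint_dist_eq_abs abs_mult)
      also have "\<dots> \<le> \<bar>real n * z $ j - b j\<bar>" by (rule nint_dist_le)
      also have "\<dots> = \<bar>real n * (z $ j - b j / n)\<bar>" using n by (simp add: right_diff_distrib)
      also have "\<dots> = real n * \<bar>z $ j - b j / n\<bar>" by (simp add: abs_mult)
      finally show ?thesis using n by simp
    qed
    then have "w \<in> Z0" using Z0(1) b w unfolding strongly_star_shaped_def by (meson order_trans)
    moreover have "w - (1 / real n) *\<^sub>R int_vec (\<lambda>_. 0) = w" by (simp add: vec_eq_iff)
    ultimately have "w \<in> P" unfolding P_def mem_Collect_eq by metis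
    moreover have "\<bar>w $ j\<bar> < 1 / (2 * real n)" for j
      using z w by (auto simp: Z_def intro: le_less_trans)
    ultimately show "w \<in> Z" using SP by (simp add: Z_def)
  qed
  moreover have "\<bar>z $ j\<bar> \<le> D" if z: "z \<in> Z" for z j
  proof -
    obtain i where i: "i \<in> I m" "nint_dist (real n * z $ j) \<in> U m i j n"
      using z by (auto simp: Z_def S_def)
    have "real n * \<bar>z $ j\<bar> < 1 / 2" using z n by (auto simp: Z_def field_simps)
    then have "real n * \<bar>z $ j\<bar> = nint_dist (real n * z $ j)"
      by (simp add: nint_dist_eq_abs abs_mult)
    then have "real n * \<bar>z $ j\<bar> < real n * d m i j" using U_sub[OF i] by linarith
    then have "\<bar>z $ j\<bar> < d m i j" by (rule mult_left_less_imp_less) simp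
    then show ?thesis using C[OF i(1), of j] by simp
  qed
  moreover have "\<bar>z $ j\<bar> < 1 / (2 * real n)" if "z \<in> Z" for z j
    using that by (simp add: Z_def)
  ultimately show ?thesis
    using S_borel Z_borel S_fill torus_A
    by (intro exI[of _ S] exI[of _ Z] conjI ballI allI)
qed

section \<open>Summation over all pairs\<close>

text \<open>For each pair the bound is used whose error carries the larger index first, the range in
  which the row sums of \<open>E\<close> are at most \<open>R\<close>. The two triangles n' \<le> n
  and n \<le> n' each contribute \<open>R\<close> times the sum of \<open>\<mu>\<close>.\<close>

lemma sum_square_le_of_symmetric_bound:
  fixes \<mu> :: "nat \<Rightarrow> real" and ov E :: "nat \<Rightarrow> nat \<Rightarrow> real"
  assumes \<mu>: "\<And>n. \<mu> n \<ge> 0" and E: "\<And>n n'. E n n' \<ge> 0"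
    and R: "\<And>n. n > 0 \<Longrightarrow> (\<Sum>n'=1..n. E n n') \<le> R"
    and bound: "\<And>n n'. n > 0 \<Longrightarrow> n' > 0 \<Longrightarrow> ov n n' \<le> \<mu> n * \<mu> n' + \<mu> n * E n n'"
    and bound': "\<And>n n'. n > 0 \<Longrightarrow> n' > 0 \<Longrightarrow> ov n n' \<le> \<mu> n * \<mu> n' + \<mu> n' * E n' n"
  shows "(\<Sum>n=1..N. \<Sum>n'=1..N. ov n n') \<le> (\<Sum>n=1..N. \<mu> n)\<^sup>2 + 2 * R * (\<Sum>n=1..N. \<mu> n)"
proof -
  define F where "F n n' = (if n' \<le> n then \<mu> n * E n n' else 0)" for n n'
  have F: "(\<Sum>n=1..N. \<Sum>n'=1..N. F n n') \<le> R * (\<Sum>n=1..N. \<mu> n)"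
  proof -
    have "(\<Sum>n'=1..N. F n n') \<le> R * \<mu> n" if n: "n \<in> {1..N}" for n
    proof -
      have "{1..N} \<inter> {n'. n' \<le> n} = {1..n}" using n by auto
      then have "(\<Sum>n'=1..N. F n n') = \<mu> n * (\<Sum>n'=1..n. E n n')"
        by (simp add: F_def sum.If_cases sum_distrib_left)
      also have "\<dots> \<le> \<mu> n * R" using n \<mu> R by (intro mult_left_mono) auto
      finally show ?thesis by (simp add: mult.commute)
    qed
    then show ?thesis unfolding sum_distrib_left by (rule sum_mono)
  qed
  have "ov n n' \<le> \<mu> n * \<mu> n' + F n n' + F n' n" if "n \<in> {1..N}" "n' \<in> {1..N}" for n n'
  proof -
    have "F n n' \<ge> 0" "F n' n \<ge> 0" using \<mu> E by (simp_all add: F_def)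
    show ?thesis
    proof (cases "n' \<le> n")
      case True
      then have "F n n' = \<mu> n * E n n'" by (simp add: F_def)
      then show ?thesis using bound[of n n'] that \<open>F n' n \<ge> 0\<close> by simp
    next
      case False
      then have "F n' n = \<mu> n' * E n' n" by (simp add: F_def)
      then show ?thesis using bound'[of n n'] that \<open>F n n' \<ge> 0\<close> by simp
    qed
  qed
  then have "(\<Sum>n=1..N. \<Sum>n'=1..N. ov n n') \<le> (\<Sum>n=1..N. \<Sum>n'=1..N. \<mu> n * \<mu> n' + F n n' + F n' n)"
    by (rule sum_mono[OF sum_mono])
  also have "\<dots> = (\<Sum>n=1..N. \<Sum>n'=1..N. \<mu> n * \<mu> n') + (\<Sum>n=1..N. \<Sum>n'=1..N. F n n') + (\<Sum>n=1..N. \<Sum>n'=1..N. F n' n)"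
    by (simp only: sum.distrib)
  also have "(\<Sum>n=1..N. \<Sum>n'=1..N. F n' n) = (\<Sum>n=1..N. \<Sum>n'=1..N. F n n')"
    by (rule sum.swap)
  also have "(\<Sum>n=1..N. \<Sum>n'=1..N. \<mu> n * \<mu> n') = (\<Sum>n=1..N. \<mu> n)\<^sup>2"
    unfolding power2_eq_square by (rule sum_product[symmetric])
  also have "(\<Sum>n=1..N. \<mu> n)\<^sup>2 + (\<Sum>n=1..N. \<Sum>n'=1..N. F n n') + (\<Sum>n=1..N. \<Sum>n'=1..N. F n n')
    \<le> (\<Sum>n=1..N. \<mu> n)\<^sup>2 + R * (\<Sum>n=1..N. \<mu> n) + R * (\<Sum>n=1..N. \<mu> n)"
    by (intro add_mono order_refl F)
  finally show ?thesis by (simp only: mult_2 distrib_right add.assoc)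
qed

theorem mainTheorem13:
  fixes \<tau> :: real
    and I :: "nat \<Rightarrow> 'i set"
    and d :: "nat \<Rightarrow> 'i \<Rightarrow> 'k::finite \<Rightarrow> real"
    and U :: "nat \<Rightarrow> 'i \<Rightarrow> 'k \<Rightarrow> nat \<Rightarrow> real set"
    and A :: "nat \<Rightarrow> (real ^ 'k) set"
  assumes "CARD('k) \<ge> 3"
    and "admissible_set_system \<tau> 0 I d U A"
  shows "\<exists>C::real. \<forall>\<gamma> :: nat \<Rightarrow> nat \<Rightarrow> real ^ 'k. \<forall>N::nat.
    (\<Sum>n=1..N. \<Sum>n'=1..N.
        measure lebesgue (torus (A n) \<inter> torus ((\<lambda>x. x + \<gamma> n n') ` A n')))
      \<le> (\<Sum>n=1..N. measure lebesgue (torus (A n)))\<^sup>2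
        + C * (\<Sum>n=1..N. measure lebesgue (torus (A n)))"
proof -
  interpret admissible_set_system \<tau> 0 I d U A by fact
  \<comment> \<open>The upper bound on the numbers d reads C n^-(1+\<eta>); \<eta> is positive
    because \<tau> < 1/k.\<close>
  define \<eta> where "\<eta> = 1 / real CARD('k) - \<tau>"
  have \<eta>: "\<eta> > 0" using tau by (simp add: \<eta>_def)
  obtain c C where C: "C > 0" and
    dC: "\<forall>m\<ge>1. \<forall>i\<in>I m. \<forall>j. \<forall>n\<in>dyadic m.
      c * real n powr (- (1 + 1 / real CARD('k) + \<tau>)) \<le> d m i j \<and>
      d m i j \<le> C * real n powr (- (1 + 1 / real CARD('k) - \<tau>))"
    using d_bounds by blast
  define D where "D n = C * real n powr (- (1 + \<eta>))" for n
  \<comment> \<open>The two sets are packed into a pair for a single use of choice. The index 0 is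
    left out, since it lies in no dyadic block.\<close>
  have "\<forall>n\<in>{1..}. \<exists>SZ. fst SZ \<in> sets borel \<and> snd SZ \<in> sets borel \<and> strongly_star_shaped (snd SZ)
    \<and> (\<forall>z\<in>snd SZ. \<forall>j. \<bar>z $ j\<bar> < 1 / (2 * real n) \<and> \<bar>z $ j\<bar> \<le> D n)
    \<and> fst SZ = {x. \<exists>b. x - (1 / real n) *\<^sub>R int_vec b \<in> snd SZ}
    \<and> (\<forall>\<gamma>. torus ((\<lambda>x. x + \<gamma>) ` A n) = unit_cube \<inter> {x. x - \<gamma> \<in> fst SZ})"
  proof
    fix n :: nat assume "n \<in> {1..}"
    then obtain m where m: "m \<ge> 1" "n \<in> dyadic m" using ex_dyadic[of n] by auto
    have "d m i j \<le> D n" if "i \<in> I m" for i j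
      using dC m that by (auto simp: D_def \<eta>_def add_diff_eq)
    from homogeneous_structure[OF refl m this] show "\<exists>SZ. fst SZ \<in> sets borel \<and> snd SZ \<in> sets borel \<and> strongly_star_shaped (snd SZ)
    \<and> (\<forall>z\<in>snd SZ. \<forall>j. \<bar>z $ j\<bar> < 1 / (2 * real n) \<and> \<bar>z $ j\<bar> \<le> D n)
    \<and> fst SZ = {x. \<exists>b. x - (1 / real n) *\<^sub>R int_vec b \<in> snd SZ}
    \<and> (\<forall>\<gamma>. torus ((\<lambda>x. x + \<gamma>) ` A n) = unit_cube \<inter> {x. x - \<gamma> \<in> fst SZ})"
      by (simp only: split_paired_Ex fst_conv snd_conv)
  qed
  then obtain SZ where SZ: "\<forall>n\<in>{1..}. fst (SZ n) \<in> sets borel \<and> snd (SZ n) \<in> sets borel \<and> strongly_star_shaped (snd (SZ n))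
    \<and> (\<forall>z\<in>snd (SZ n). \<forall>j. \<bar>z $ j\<bar> < 1 / (2 * real n) \<and> \<bar>z $ j\<bar> \<le> D n)
    \<and> fst (SZ n) = {x. \<exists>b. x - (1 / real n) *\<^sub>R int_vec b \<in> snd (SZ n)}
    \<and> (\<forall>\<gamma>. torus ((\<lambda>x. x + \<gamma>) ` A n) = unit_cube \<inter> {x. x - \<gamma> \<in> fst (SZ n)})"
    by (rule bchoice[THEN exE])
  define S where "S n = fst (SZ n)" for n
  define Z where "Z n = snd (SZ n)" for n
  have S_borel: "S n \<in> sets borel" and Z_borel: "Z n \<in> sets borel" and Z_star: "strongly_star_shaped (Z n)"
    and Z_small: "\<And>z j. z \<in> Z n \<Longrightarrow> \<bar>z $ j\<bar> < 1 / (2 * real n)"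
    and Z_D: "\<And>z j. z \<in> Z n \<Longrightarrow> \<bar>z $ j\<bar> \<le> D n"
    and S_fill: "S n = {x. \<exists>b. x - (1 / real n) *\<^sub>R int_vec b \<in> Z n}"
    and torus_A: "\<And>\<gamma>. torus ((\<lambda>x. x + \<gamma>) ` A n) = unit_cube \<inter> {x. x - \<gamma> \<in> S n}"
    if "n > 0" for n
    using SZ[rule_format, of n] that unfolding S_def Z_def by auto
  have torus_A0: "torus (A n) = unit_cube \<inter> S n" if "n > 0" for n
    using torus_A[OF that, of 0] by simp
  define \<mu> where "\<mu> n = measure lebesgue (torus (A n))" for n
  have \<mu>: "\<mu> n = measure lborel (unit_cube \<inter> S n)" if "n > 0" for n
    using S_borel[OF that] by (simp add: \<mu>_def torus_A0[OF that])
  define E where "E n n' = (real (gcd n n') / real n) ^ 3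
     + (1 + 4 * C) ^ CARD('k) * (real (gcd n n') / real n * real n' powr (- \<eta>))" for n n'
  have overlap: "measure lborel (unit_cube \<inter> S n \<inter> {x. x - \<gamma> \<in> S n'}) \<le> \<mu> n * \<mu> n' + \<mu> n * E n n'"
    if n: "n > 0" "n' > 0" for n n' \<gamma>
  proof -
    define X where "X = 2 * real (nat \<lfloor>2 * real (lcm n n') * D n'\<rfloor>)"
    have "D n' \<ge> 0" using C by (simp add: D_def)
    note overlap_le[OF S_borel[OF n(1)] lattice_fill_periodic[OF S_fill[OF n(1)]] S_borel[OF n(2)] S_fill[OF n(2)]
      Z_borel[OF n(2)] Z_star[OF n(2)] Z_small[OF n(2)] Z_D[OF n(2)] this n X_def, of \<gamma>]
    also have "(real (gcd n n') / real n) ^ CARD('k) * ((X + 1) ^ CARD('k) - X ^ CARD('k)) \<le> E n n'"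
      unfolding E_def using C \<eta> assms(1) by (intro overlap_error_le[OF n]) (auto simp: X_def D_def)
    finally show ?thesis by (simp add: \<mu> n mult_left_mono)
  qed
  obtain K where K: "K \<ge> 0" "\<And>n. n > 0 \<Longrightarrow> (\<Sum>n'=1..n. real (gcd n n') / real n * real n' powr (-\<eta>)) \<le> K"
    using sum_gcd_powr_le[OF \<eta>] by blast
  \<comment> \<open>The 2 bounds the sum of cubes and \<open>K\<close> the weighted gcd sum. Neither
    depends on \<gamma> or N, so the constant can be fixed before these are introduced.\<close>
  define R where "R = 2 + (1 + 4 * C) ^ CARD('k) * K"
  have R: "(\<Sum>n'=1..n. E n n') \<le> R" if n: "n > 0" for n
  proof -
    have "(\<Sum>n'=1..n. E n n') = (\<Sum>n'=1..n. (real (gcd n n') / real n) ^ 3)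
      + (1 + 4 * C) ^ CARD('k) * (\<Sum>n'=1..n. real (gcd n n') / real n * real n' powr (-\<eta>))"
      unfolding E_def sum.distrib sum_distrib_left ..
    also have "\<dots> \<le> R"
      unfolding R_def using C by (intro add_mono sum_gcd_cube_le n mult_left_mono K(2)) auto
    finally show ?thesis .
  qed
  show ?thesis
  proof (intro exI[of _ "2 * R"] allI)
    fix \<gamma> :: "nat \<Rightarrow> nat \<Rightarrow> real ^ 'k" and N :: nat
    define ov where "ov n n' = measure lebesgue (torus (A n) \<inter> torus ((\<lambda>x. x + \<gamma> n n') ` A n'))" for n n'
    have ov: "ov n n' = measure lborel (unit_cube \<inter> S n \<inter> {x. x - \<gamma> n n' \<in> S n'})" if n: "n > 0" "n' > 0" for n n'
    proof -
      note [measurable] = S_borel[OF n(1)] S_borel[OF n(2)]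
      have "unit_cube \<inter> S n \<inter> {x. x - \<gamma> n n' \<in> S n'} \<in> sets borel" by measurable
      moreover have "torus (A n) \<inter> torus ((\<lambda>x. x + \<gamma> n n') ` A n') = unit_cube \<inter> S n \<inter> {x. x - \<gamma> n n' \<in> S n'}"
        using n by (auto simp: torus_A torus_A0)
      ultimately show ?thesis by (simp add: ov_def)
    qed
    \<comment> \<open>Moving the whole intersection by -\<gamma> exchanges the roles: the overlap of
      A_n with A_n' + \<gamma> is that of A_n' with A_n - \<gamma>. Shifts being arbitrary, the same
      overlap estimate covers this form too.\<close>
    have ov': "ov n n' = measure lborel (unit_cube \<inter> S n' \<inter> {x. x - (- \<gamma> n n') \<in> S n})" if n: "n > 0" "n' > 0" for n n'
    proof -
      note [measurable] = S_borel[OF n(1)] S_borel[OF n(2)]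
      define X where "X = {x. x + \<gamma> n n' \<in> S n \<and> x \<in> S n'}"
      have X: "X \<in> sets borel" unfolding X_def by measurable
      have "x + int_vec c \<in> X \<longleftrightarrow> x \<in> X" for x c
        using int_periodic[OF n(1) lattice_fill_periodic[OF S_fill[OF n(1)]], of "x + \<gamma> n n'" c]
          int_periodic[OF n(2) lattice_fill_periodic[OF S_fill[OF n(2)]], of x c]
        by (simp add: X_def add.assoc add.commute[of "int_vec c"])
      from measure_periodic_translate[OF X this, of "- \<gamma> n n'"]
      have "measure lborel (unit_cube \<inter> {x. x + - \<gamma> n n' \<in> X}) = measure lborel (unit_cube \<inter> X)" .
      moreover have "unit_cube \<inter> {x. x + - \<gamma> n n' \<in> X} = unit_cube \<inter> S n \<inter> {x. x - \<gamma> n n' \<in> S n'}"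
        by (auto simp: X_def)
      moreover have "unit_cube \<inter> X = unit_cube \<inter> S n' \<inter> {x. x - (- \<gamma> n n') \<in> S n}"
        by (auto simp: X_def)
      ultimately show ?thesis using ov[OF n] by simp
    qed
    have "(\<Sum>n=1..N. \<Sum>n'=1..N. ov n n') \<le> (\<Sum>n=1..N. \<mu> n)\<^sup>2 + 2 * R * (\<Sum>n=1..N. \<mu> n)"
    proof (rule sum_square_le_of_symmetric_bound[OF _ _ R])
      show "\<mu> n \<ge> 0" for n by (simp add: \<mu>_def)
      show "E n n' \<ge> 0" for n n' using C by (simp add: E_def)
      show "ov n n' \<le> \<mu> n * \<mu> n' + \<mu> n * E n n'" if "n > 0" "n' > 0" for n n'
        using overlap[OF that] ov[OF that] by simp
      show "ov n n' \<le> \<mu> n * \<mu> n' + \<mu> n' * E n' n" if "n > 0" "n' > 0" for n n'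
        using overlap[OF that(2,1), of "- \<gamma> n n'"] ov'[OF that] by (simp add: mult.commute)
    qed
    then show "(\<Sum>n=1..N. \<Sum>n'=1..N. measure lebesgue (torus (A n) \<inter> torus ((\<lambda>x. x + \<gamma> n n') ` A n')))
      \<le> (\<Sum>n=1..N. measure lebesgue (torus (A n)))\<^sup>2 + 2 * R * (\<Sum>n=1..N. measure lebesgue (torus (A n)))"
      unfolding ov_def \<mu>_def .
  qed
qed

end
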